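(* Let $B\in\mathbb{R}^{m\times n}$, $P\in\mathbb{R}^{q\times n}$, $b\in\mathbb{R}^m$, let $C\subseteq\mathbb{R}^q$ be a solid pointed polyhedral convex cone, and let $c\in\operatorname{int}C$ with $c_q=1$. Let $S=\{x\in\mathbb{R}^n\mid Bx\ge b\}\neq\emptyset$, suppose that the polyhedral cone $\mathcal{P}^h=P[S^h]+C$, where $S^h=\{x\in\mathbb{R}^n\mid Bx\ge 0\}$, has a vertex, and assume that the command $$(\mathcal{T}_{points},\mathcal{T}_{dirs})\leftarrow \mathrm{dual}(\mathcal{T}^*_{points},\mathcal{T}^*_{dirs})$$ generates a minimal V-representation of $\mathcal{T}$ from a given V-representation of $\mathcal{T}^*$, where $\mathcal{T}$ and $\mathcal{T}^*$ are related by $\mathcal{T}^*=\{y^*\in\mathbb{R}^q\mid \varphi(y,y^* )\ge 0 \text{ for all } y\in\mathcal{T}\}$. Then Algorithm 1 (described in the context), with input a solution $(\{0\},\bar S^h)$ to (P$^h$) and a solution $\bar T^h$ to (D$^{*h}$), is correct and finite. That is, every step can be carried out, the algorithm terminates after finitely many steps, and upon termination: $(\bar S,\bar S^h)$ is a solution to (P); $\bar T$ is a solution to (D$^*$); $(\mathcal{T}_{points},\mathcal{T}_{dirs})$ is a V-representation of the upper image $\mathcal{P}=P[S]+C$; and $(\mathcal{T}^*_{points},\{-e^q\})$ is a V-representation of the lower image $\mathcal{D}^*$. This holds both with and without the optional break command.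
   Context: Notation. $y\le_C y'$ means $y'-y\in C$. Solid means having nonempty interior; pointed means containing no lines. $C^+=\{w\in\mathbb{R}^q\mid w^Ty\ge 0\ \forall y\in C\}$. $e^q$ is the $q$-th unit vector. $Y$ is a matrix whose columns generate $C$; $Z$ is a matrix whose columns generate $C^+$. $P[A]=\{Px\mid x\in A\}$. $\operatorname{cone}\emptyset=\{0\}$. A pair $(A_{points},A_{dirs})$ of finite sets of points and directions is a V-representation of a polyhedron $A$ if $A=\operatorname{conv}A_{points}+\operatorname{cone}A_{dirs}$; it is minimal if $A_{points}$ consists only of vertices of $A$ and $A_{dirs}$ only of extreme directions of $A$ (nonzero vectors spanning half-line faces). Primal problem (P): minimize $Px$ with respect to $\le_C$ subject to $x\in S$. Its homogeneous problem (P$^h$) is the same problem with $b$ replaced by $0$ (feasible set $S^h$). A point $\bar x\in S$ is a minimizer of (P) if there is no $x\in S$ with $Px\le_C P\bar x$ and $Px\ne P\bar x$. A direction $k\in S^h\setminus\{0\}$ is a minimizer for (P) if the point $k$ is a minimizer of (P$^h$). A pair $(\bar S,\bar S^h)$ with $\bar S\subseteq S$ nonempty finite and $\bar S^h\subseteq S^h\setminus\{0\}$ finite (possibly empty) is a finite infimizer if $\operatorname{conv}P[\bar S]+\operatorname{cone}P[\bar S^h]+C=P[S]+C$. A finite infimizer is a solution to (P) if $\bar S$ and $\bar S^h$ consist only of minimizers. The same definitions apply to (P$^h$), i.e. with $b=0$. Dual problem (D$^*$): maximize $D^*(u,w)=(w_1,\dots,w_{q-1},b^Tu)^T$ with respect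 to $\le_K$, $K=\mathbb{R}_+\cdot e^q$, over $$T=\{(u,w)\in\mathbb{R}^m\times\mathbb{R}^q\mid u\ge 0,\ B^Tu=P^Tw,\ c^Tw=1,\ Y^Tw\ge 0\}.$$ (D$^{*h}$) is the same problem with objective $D^{*h}(u,w)=(w_1,\dots,w_{q-1},0)^T$ (same feasible set $T$). A point $(\bar u,\bar w)\in T$ is a maximizer of (D$^*$) if there is no $(u,w)\in T$ with $D^*(u,w)\ge_K D^*(\bar u,\bar w)$ and $D^*(u,w)\neq D^*(\bar u,\bar w)$. A nonempty finite $\bar T\subseteq T$ is a finite supremizer if $\operatorname{conv}D^*[\bar T]-K=D^*[T]-K$; it is a solution to (D$^*$) if in addition it consists only of maximizers. The same definitions apply to (D$^{*h}$) with $D^{*h}$ in place of $D^*$. The lower image is $\mathcal{D}^*=D^*[T]-K$. Coupling function: $\varphi(y,y^* )=\sum_{i=1}^{q-1}y_iy_i^*+y_q\bigl(1-\sum_{i=1}^{q-1}c_iy_i^*\bigr)-y_q^*$. Linear programs: (D$_1(w)$): $\max b^Tu$ s.t. $B^Tu=P^Tw$, $u\ge 0$. (P$_2(t)$): $\min z$ over $(x,z)\in\mathbb{R}^n\times\mathbb{R}$ s.t. $Bx\ge b$, $Z^TPx\le Z^Tt+z\,Z^Tc$. (D$_2(t)$): $\max b^Tu-t^Tw$ s.t. $B^Tu-P^Tw=0$, $c^Tw=1$, $Y^Tw\ge 0$, $u\ge 0$. The routine solve() returns an (arbitrary) optimal solution of the given linear program; solve(P$_2(t)$/D$_2(t)$)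 returns an optimal solution $(x,z)$ of (P$_2(t)$) and an optimal solution $(u,w)$ of (D$_2(t)$). The routine dual$(\mathcal{T}^*_{points},\{-e^q\})$: with $\mathcal{T}^*=\operatorname{conv}\mathcal{T}^*_{points}+\operatorname{cone}\{-e^q\}$, it returns a V-representation of $\mathcal{T}=\{y\in\mathbb{R}^q\mid\varphi(y,y^* )\ge 0\text{ for all }y^*\in\mathcal{T}^*\}$. Algorithm 1. Input: the data $B,b,P,Z$ of (P), a solution $(\{0\},\bar S^h)$ to (P$^h$), a solution $\bar T^h$ to (D$^{*h}$). Step 0: $\bar T\leftarrow\{(\mathrm{solve}(\mathrm{D}_1(w)),w)\mid (u,w)\in\bar T^h\}$. Repeat the following until $flag=0$ at the end of a pass: (i) $flag\leftarrow 0$; $\bar S\leftarrow\emptyset$; $\mathcal{T}^*_{points}\leftarrow\{D^*(u,w)\mid(u,w)\in\bar T\}$; $(\mathcal{T}_{points},\mathcal{T}_{dirs})\leftarrow\mathrm{dual}(\mathcal{T}^*_{points},\{-e^q\})$. (ii) For each $t\in\mathcal{T}_{points}$ in turn: $(x,z,u,w)\leftarrow\mathrm{solve}(\mathrm{P}_2(t)/\mathrm{D}_2(t))$; if $z>0$, set $\bar T\leftarrow\bar T\cup\{(u,w)\}$, $flag\leftarrow 1$, and (optionally) break, i.e. exit the for-loop; otherwise set $\bar S\leftarrow\bar S\cup\{x\}$. Output: $(\bar S,\bar S^h)$, $\bar T$, $(\mathcal{T}_{points},\mathcal{T}_{dirs})$, $(\mathcal{T}^*_{points},\{-e^q\})$.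 *)

theory Defs
  imports "HOL-Analysis.Analysis" "HOL-Library.Set_Algebras"
begin

text \<open>
  Conventions. Sums \<open>A + B\<close> of sets are Minkowski sums; \<open>A - K\<close> in the sense of Minkowski is
  written \<open>A + uminus ` K\<close>, since \<open>-\<close> on sets is set difference. The cone generated by a set
  is \<open>convex_cone hull\<close>, which sends the empty set to \<open>{0}\<close>, unlike \<open>cone hull\<close>.
  Inequalities between vectors of type \<open>real ^ 'n\<close> are componentwise.
  The coordinates of the image space are indexed by a finite linear order whose greatest
  element plays the role of the index \<open>q\<close>.
\<close>

section \<open>Polyhedral notions\<close>

definition last_index :: "'q::{finite,linorder}" where
  "last_index = Max UNIV"

definition e_last :: "real ^ 'q::{finite,linorder}" where
  "e_last = axis last_index 1"

definition pointed :: "'a::real_vector set \<Rightarrow> bool" where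
  "pointed A \<longleftrightarrow> \<not> (\<exists>x d. d \<noteq> 0 \<and> (\<forall>t::real. x + t *\<^sub>R d \<in> A))"

definition dual_cone :: "'a::real_inner set \<Rightarrow> 'a set" where
  "dual_cone C = {w. \<forall>y\<in>C. w \<bullet> y \<ge> 0}"

definition cone_le :: "'a::real_vector set \<Rightarrow> 'a \<Rightarrow> 'a \<Rightarrow> bool" where
  "cone_le C y y' \<longleftrightarrow> y' - y \<in> C"

definition extreme_direction_of :: "'a::real_vector \<Rightarrow> 'a set \<Rightarrow> bool" where
  "extreme_direction_of d A \<longleftrightarrow> d \<noteq> 0 \<and> (\<exists>v. {v + t *\<^sub>R d |t::real. t \<ge> 0} face_of A)"

text \<open>Directions are nonzero vectors.\<close>

definition V_representation :: "'a::real_vector set \<Rightarrow> 'a set \<Rightarrow> 'a set \<Rightarrow> bool" where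
  "V_representation A pts dirs \<longleftrightarrow>
     finite pts \<and> finite dirs \<and> 0 \<notin> dirs \<and> A = convex hull pts + convex_cone hull dirs"

definition minimal_V_representation :: "'a::real_vector set \<Rightarrow> 'a set \<Rightarrow> 'a set \<Rightarrow> bool" where
  "minimal_V_representation A pts dirs \<longleftrightarrow>
     V_representation A pts dirs \<and>
     (\<forall>v\<in>pts. v extreme_point_of A) \<and> (\<forall>d\<in>dirs. extreme_direction_of d A)"

section \<open>The primal problem\<close>

text \<open>The homogeneous problem is obtained by taking \<open>b = 0\<close> throughout.\<close>

definition feasible :: "real ^ 'n ^ 'm \<Rightarrow> real ^ 'm \<Rightarrow> (real ^ 'n) set" where
  "feasible B b = {x. B *v x \<ge> b}"

definition upper_image ::
    "real ^ 'n ^ 'm \<Rightarrow> real ^ 'm \<Rightarrow> real ^ 'n ^ 'q \<Rightarrow> (real ^ 'q) set \<Rightarrow> (real ^ 'q) set" where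
  "upper_image B b P C = (*v) P ` feasible B b + C"

definition minimizer ::
    "real ^ 'n ^ 'm \<Rightarrow> real ^ 'm \<Rightarrow> real ^ 'n ^ 'q \<Rightarrow> (real ^ 'q) set \<Rightarrow> real ^ 'n \<Rightarrow> bool" where
  "minimizer B b P C x \<longleftrightarrow>
     x \<in> feasible B b \<and>
     \<not> (\<exists>x'\<in>feasible B b. cone_le C (P *v x') (P *v x) \<and> P *v x' \<noteq> P *v x)"

definition minimizer_direction ::
    "real ^ 'n ^ 'm \<Rightarrow> real ^ 'n ^ 'q \<Rightarrow> (real ^ 'q) set \<Rightarrow> real ^ 'n \<Rightarrow> bool" where
  "minimizer_direction B P C k \<longleftrightarrow> k \<in> feasible B 0 - {0} \<and> minimizer B 0 P C k"

definition finite_infimizer ::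
    "real ^ 'n ^ 'm \<Rightarrow> real ^ 'm \<Rightarrow> real ^ 'n ^ 'q \<Rightarrow> (real ^ 'q) set \<Rightarrow>
     (real ^ 'n) set \<Rightarrow> (real ^ 'n) set \<Rightarrow> bool" where
  "finite_infimizer B b P C S Sh \<longleftrightarrow>
     finite S \<and> S \<noteq> {} \<and> S \<subseteq> feasible B b \<and>
     finite Sh \<and> Sh \<subseteq> feasible B 0 - {0} \<and>
     convex hull ((*v) P ` S) + convex_cone hull ((*v) P ` Sh) + C = (*v) P ` feasible B b + C"

definition primal_solution ::
    "real ^ 'n ^ 'm \<Rightarrow> real ^ 'm \<Rightarrow> real ^ 'n ^ 'q \<Rightarrow> (real ^ 'q) set \<Rightarrow>
     (real ^ 'n) set \<Rightarrow> (real ^ 'n) set \<Rightarrow> bool" where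
  "primal_solution B b P C S Sh \<longleftrightarrow>
     finite_infimizer B b P C S Sh \<and>
     (\<forall>x\<in>S. minimizer B b P C x) \<and> (\<forall>k\<in>Sh. minimizer_direction B P C k)"

section \<open>The geometric dual problem\<close>

text \<open>
  The feasible set does not depend on \<open>b\<close>; the homogeneous dual objective is \<open>dual_obj 0\<close>.
\<close>

definition dual_feasible ::
    "real ^ 'n ^ 'm \<Rightarrow> real ^ 'n ^ 'q \<Rightarrow> real ^ 'q \<Rightarrow> real ^ 'k ^ 'q \<Rightarrow>
     ((real ^ 'm) \<times> (real ^ 'q)) set" where
  "dual_feasible B P c Y =
     {(u, w). u \<ge> 0 \<and> transpose B *v u = transpose P *v w \<and> c \<bullet> w = 1 \<and> transpose Y *v w \<ge> 0}"

definition dual_obj ::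
    "real ^ 'm \<Rightarrow> (real ^ 'm) \<times> (real ^ 'q::{finite,linorder}) \<Rightarrow> real ^ 'q::{finite,linorder}" where
  "dual_obj b = (\<lambda>(u, w). \<chi> i. if i = last_index then b \<bullet> u else w $ i)"

definition K_cone :: "(real ^ 'q::{finite,linorder}) set" where
  "K_cone = {t *\<^sub>R e_last |t. t \<ge> 0}"

definition lower_image ::
    "real ^ 'n ^ 'm \<Rightarrow> real ^ 'm \<Rightarrow> real ^ 'n ^ 'q::{finite,linorder} \<Rightarrow> real ^ 'q::{finite,linorder} \<Rightarrow>
     real ^ 'k ^ 'q::{finite,linorder} \<Rightarrow> (real ^ 'q::{finite,linorder}) set" where
  "lower_image B b P c Y = dual_obj b ` dual_feasible B P c Y + uminus ` K_cone"

definition maximizer ::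
    "real ^ 'n ^ 'm \<Rightarrow> real ^ 'm \<Rightarrow> real ^ 'n ^ 'q::{finite,linorder} \<Rightarrow> real ^ 'q::{finite,linorder} \<Rightarrow>
     real ^ 'k ^ 'q::{finite,linorder} \<Rightarrow> (real ^ 'm) \<times> (real ^ 'q::{finite,linorder}) \<Rightarrow> bool" where
  "maximizer B b P c Y p \<longleftrightarrow>
     p \<in> dual_feasible B P c Y \<and>
     \<not> (\<exists>p'\<in>dual_feasible B P c Y.
          cone_le K_cone (dual_obj b p) (dual_obj b p') \<and> dual_obj b p' \<noteq> dual_obj b p)"

definition finite_supremizer ::
    "real ^ 'n ^ 'm \<Rightarrow> real ^ 'm \<Rightarrow> real ^ 'n ^ 'q::{finite,linorder} \<Rightarrow> real ^ 'q::{finite,linorder} \<Rightarrow>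
     real ^ 'k ^ 'q::{finite,linorder} \<Rightarrow> ((real ^ 'm) \<times> (real ^ 'q::{finite,linorder})) set \<Rightarrow> bool" where
  "finite_supremizer B b P c Y T \<longleftrightarrow>
     finite T \<and> T \<noteq> {} \<and> T \<subseteq> dual_feasible B P c Y \<and>
     convex hull (dual_obj b ` T) + uminus ` K_cone
       = dual_obj b ` dual_feasible B P c Y + uminus ` K_cone"

definition dual_solution ::
    "real ^ 'n ^ 'm \<Rightarrow> real ^ 'm \<Rightarrow> real ^ 'n ^ 'q::{finite,linorder} \<Rightarrow> real ^ 'q::{finite,linorder} \<Rightarrow>
     real ^ 'k ^ 'q::{finite,linorder} \<Rightarrow> ((real ^ 'm) \<times> (real ^ 'q::{finite,linorder})) set \<Rightarrow> bool" where
  "dual_solution B b P c Y T \<longleftrightarrow>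
     finite_supremizer B b P c Y T \<and> (\<forall>p\<in>T. maximizer B b P c Y p)"

definition coupling ::
    "real ^ 'q::{finite,linorder} \<Rightarrow> real ^ 'q::{finite,linorder} \<Rightarrow> real ^ 'q::{finite,linorder} \<Rightarrow> real" where
  "coupling c y y' =
     (\<Sum>i\<in>UNIV - {last_index}. y $ i * y' $ i)
     + y $ last_index * (1 - (\<Sum>i\<in>UNIV - {last_index}. c $ i * y' $ i))
     - y' $ last_index"

section \<open>Subroutines\<close>

text \<open>
  Each subroutine is given by the relation between its input and the results it may return.
\<close>

definition optimal_D1 ::
    "real ^ 'n ^ 'm \<Rightarrow> real ^ 'm \<Rightarrow> real ^ 'n ^ 'q \<Rightarrow> real ^ 'q \<Rightarrow> real ^ 'm \<Rightarrow> bool" where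
  "optimal_D1 B b P w =
     is_arg_max (\<lambda>u. b \<bullet> u) (\<lambda>u. transpose B *v u = transpose P *v w \<and> u \<ge> 0)"

definition optimal_P2 ::
    "real ^ 'n ^ 'm \<Rightarrow> real ^ 'm \<Rightarrow> real ^ 'n ^ 'q \<Rightarrow> real ^ 'q \<Rightarrow> real ^ 'l ^ 'q \<Rightarrow>
     real ^ 'q \<Rightarrow> (real ^ 'n) \<times> real \<Rightarrow> bool" where
  "optimal_P2 B b P c Z t =
     is_arg_min (\<lambda>(x, z). z)
       (\<lambda>(x, z). B *v x \<ge> b \<and>
          transpose Z *v (P *v x) \<le> transpose Z *v t + z *\<^sub>R (transpose Z *v c))"

definition optimal_D2 ::
    "real ^ 'n ^ 'm \<Rightarrow> real ^ 'm \<Rightarrow> real ^ 'n ^ 'q \<Rightarrow> real ^ 'q \<Rightarrow> real ^ 'k ^ 'q \<Rightarrow>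
     real ^ 'q \<Rightarrow> (real ^ 'm) \<times> (real ^ 'q) \<Rightarrow> bool" where
  "optimal_D2 B b P c Y t =
     is_arg_max (\<lambda>(u, w). b \<bullet> u - t \<bullet> w)
       (\<lambda>(u, w). transpose B *v u - transpose P *v w = 0 \<and> c \<bullet> w = 1 \<and>
          transpose Y *v w \<ge> 0 \<and> u \<ge> 0)"

text \<open>
  A call of the routine dual on a V-representation of a set \<open>Ts\<close> may return any minimal
  V-representation of the set \<open>T\<close> related to \<open>Ts\<close> through the coupling function. If
  there is none, or if \<open>Ts\<close> is not in turn determined by \<open>T\<close>, the call cannot be carried
  out.
\<close>

definition dual_returns ::
    "real ^ 'q::{finite,linorder} \<Rightarrow> (real ^ 'q::{finite,linorder}) set \<Rightarrow> (real ^ 'q::{finite,linorder}) set \<Rightarrow>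
     (real ^ 'q::{finite,linorder}) set \<Rightarrow> (real ^ 'q::{finite,linorder}) set \<Rightarrow> bool" where
  "dual_returns c Tsp Tsd Tp Td \<longleftrightarrow>
     (\<exists>T Ts. V_representation Ts Tsp Tsd \<and>
        T = {y. \<forall>y'\<in>Ts. coupling c y y' \<ge> 0} \<and>
        Ts = {y'. \<forall>y\<in>T. coupling c y y' \<ge> 0} \<and>
        minimal_V_representation T Tp Td)"

section \<open>The algorithm as a transition system\<close>

text \<open>
  The type parameters stand for \<open>real ^ 'n\<close>, \<open>(real ^ 'm) \<times> (real ^ 'q)\<close> and \<open>real ^ 'q\<close>.
  The state \<open>For_Loop todo flag S T Tp Td Tsp\<close> is the state in front of the treatment of
  the next element of \<open>todo\<close>, the elements of \<open>Tp\<close> that remain to be visited, in the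
  order of the visit. The fields of \<open>Output\<close> are the two components of the primal
  solution, the dual solution, and the components of the two V-representations.
\<close>

datatype ('x, 'd, 'y) alg_state =
    Init
  | Pass_Start "'d set"
  | For_Loop "'y list" bool "'x set" "'d set" "'y set" "'y set" "'y set"
  | Output "'x set" "'x set" "'d set" "'y set" "'y set" "'y set" "'y set"

text \<open>
  \<open>brk\<close> tells whether the optional break command is present. In the first rule,
  \<open>f\<close> collects the results of the calls of solve, one for each element of \<open>Tbarh\<close>.
\<close>

inductive alg_step ::
    "bool \<Rightarrow> real ^ 'n ^ 'm \<Rightarrow> real ^ 'm \<Rightarrow> real ^ 'n ^ 'q::{finite,linorder} \<Rightarrow> real ^ 'q::{finite,linorder} \<Rightarrow>
     real ^ 'k ^ 'q::{finite,linorder} \<Rightarrow> real ^ 'l ^ 'q::{finite,linorder} \<Rightarrow>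
     (real ^ 'n) set \<Rightarrow> ((real ^ 'm) \<times> (real ^ 'q::{finite,linorder})) set \<Rightarrow>
     (real ^ 'n, (real ^ 'm) \<times> (real ^ 'q::{finite,linorder}), real ^ 'q::{finite,linorder}) alg_state \<Rightarrow>
     (real ^ 'n, (real ^ 'm) \<times> (real ^ 'q::{finite,linorder}), real ^ 'q::{finite,linorder}) alg_state \<Rightarrow> bool"
  for brk B b P c Y Z Sbarh Tbarh
where
  step_0:
    "\<lbrakk>\<And>u w. (u, w) \<in> Tbarh \<Longrightarrow> optimal_D1 B b P w (f (u, w))\<rbrakk> \<Longrightarrow>
     alg_step brk B b P c Y Z Sbarh Tbarh
       Init (Pass_Start {(f (u, w), w) |u w. (u, w) \<in> Tbarh})"
| pass_start:
    "\<lbrakk>Tsp = {dual_obj b (u, w) |u w. (u, w) \<in> T};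
      dual_returns c Tsp {- e_last} Tp Td;
      set todo = Tp; distinct todo\<rbrakk> \<Longrightarrow>
     alg_step brk B b P c Y Z Sbarh Tbarh
       (Pass_Start T) (For_Loop todo False {} T Tp Td Tsp)"
| cut:
    "\<lbrakk>optimal_P2 B b P c Z t (x, z); optimal_D2 B b P c Y t (u, w); z > 0\<rbrakk> \<Longrightarrow>
     alg_step brk B b P c Y Z Sbarh Tbarh
       (For_Loop (t # todo) flag S T Tp Td Tsp)
       (For_Loop (if brk then [] else todo) True S (T \<union> {(u, w)}) Tp Td Tsp)"
| no_cut:
    "\<lbrakk>optimal_P2 B b P c Z t (x, z); optimal_D2 B b P c Y t (u, w); \<not> z > 0\<rbrakk> \<Longrightarrow>
     alg_step brk B b P c Y Z Sbarh Tbarh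
       (For_Loop (t # todo) flag S T Tp Td Tsp)
       (For_Loop todo flag (S \<union> {x}) T Tp Td Tsp)"
| repeat_pass:
    "alg_step brk B b P c Y Z Sbarh Tbarh
       (For_Loop [] True S T Tp Td Tsp) (Pass_Start T)"
| finish:
    "alg_step brk B b P c Y Z Sbarh Tbarh
       (For_Loop [] False S T Tp Td Tsp) (Output S Sbarh T Tp Td Tsp {- e_last})"

end

theory Submission
  imports Defs
begin

text \<open>
  At the start of a pass, the routine dual returns the outer approximation of the upper image
  consisting of all \<open>y\<close> with \<open>w\<^sup>T y \<ge> b\<^sup>T u\<close> for the pairs \<open>(u, w)\<close> found so far. The pairs coming from the
  homogeneous dual solution force its recession cone to be that of the upper image, which has a
  vertex, so the approximation contains no line and has a minimal V-representation. A vertex \<open>t\<close>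
  is either the image of a minimizer, or it lies outside the upper image; then the optimal
  solution of \<open>(D\<^sub>2(t))\<close>, whichever it is, supports the upper image along the whole face that
  contains \<open>t + z c\<close> in its relative interior. No pair found before supports that face, and there are
  finitely many faces, so all vertices eventually lie in the upper image, which then equals its
  approximation. The lower image is recovered from the biduality of the coupling function.
\<close>

section \<open>Vertices and extreme directions of pointed closed convex sets\<close>

text \<open>Counting vertices would bound the cuts if solve returned vertex solutions of (D_2(t));
  it may return any optimal solution, so progress is measured by primal faces. These are faces of
  the lifted polyhedron of pairs (x, y), not of the upper image: the former is given by the finitely
  many rows of \<open>B\<close> and columns of \<open>Z\<close>, the latter only by inequalities
  indexed by all dual feasible pairs. What separates a new pair from the old ones is the
  normalization c^T w = 1: moving from \<open>t\<close> to t + z c raises every w^T y by exactly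
  \<open>z\<close>, so an old inequality valid at \<open>t\<close> is strict there. A second burden
  is that every call must be shown to have a result. Attainment of the dual optima and Farkas' lemma
  both come from the closedness of finitely generated cones. The call of dual requires in addition
  that its input set be recovered from the outer approximation, although the coupling function
  yields only non-vertical hyperplanes.\<close>

lemma pointed_subset: "pointed A \<Longrightarrow> B \<subseteq> A \<Longrightarrow> pointed B"
  unfolding pointed_def by blast

lemma half_line_face_mem:
  assumes "{v + t *\<^sub>R d |t::real. t \<ge> 0} face_of A" "t \<ge> 0"
  shows "v + t *\<^sub>R d \<in> A"
  using face_of_imp_subset[OF assms(1)] assms(2) by blast

lemma extreme_direction_ofI:
  "d \<noteq> 0 \<Longrightarrow> {v + t *\<^sub>R d |t::real. t \<ge> 0} face_of A \<Longrightarrow> extreme_direction_of d A"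
  by (auto simp: extreme_direction_of_def)

text \<open>Convex combinations of \<open>y\<close> with ever farther points of the ray, weighted
  inversely to how far they lie, converge to \<open>y + d\<close>.\<close>

lemma recession_direction_translate:
  fixes S :: "'a::euclidean_space set"
  assumes "closed S" "convex S" and ray: "\<And>t. t \<ge> 0 \<Longrightarrow> v + t *\<^sub>R d \<in> S" and "y \<in> S"
  shows "y + d \<in> S"
proof -
  define a where "a n = inverse (real (Suc n))" for n
  have a: "0 \<le> a n" "a n \<le> 1" "a n \<noteq> 0" for n by (auto simp: a_def field_simps)
  define z where "z n = (1 - a n) *\<^sub>R y + a n *\<^sub>R (v + inverse (a n) *\<^sub>R d)" for n
  have "z n \<in> S" for n
    unfolding z_def using a[of n] by (intro convexD[OF \<open>convex S\<close> \<open>y \<in> S\<close>] ray) auto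
  moreover have "z \<longlonglongrightarrow> y + d"
  proof -
    have z: "z = (\<lambda>n. (1 - a n) *\<^sub>R y + a n *\<^sub>R v + d)"
      using a by (auto simp: z_def algebra_simps)
    have "a \<longlonglongrightarrow> 0" unfolding a_def by (rule LIMSEQ_inverse_real_of_nat)
    then have "z \<longlonglongrightarrow> (1 - 0) *\<^sub>R y + 0 *\<^sub>R v + d"
      unfolding z by (intro tendsto_intros)
    then show ?thesis by simp
  qed
  ultimately show ?thesis using closed_sequentially[OF \<open>closed S\<close>] by blast
qed

text \<open>Each generator may have its ray at a different starting point, so the translations that
  map \<open>S\<close> into itself are considered instead. They form a convex cone: a multiple by
  \<open>r\<close> is reached by convexity between \<open>y\<close> and an integer multiple.\<close>

lemma recession_convex_cone_hull:
  fixes S :: "'a::euclidean_space set"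
  assumes "closed S" "convex S" and D: "\<And>d. d \<in> D \<Longrightarrow> \<exists>v. \<forall>t\<ge>0. v + t *\<^sub>R d \<in> S"
    and "d \<in> convex_cone hull D" "y \<in> S"
  shows "y + d \<in> S"
proof -
  define R where "R = {d. \<forall>y\<in>S. y + d \<in> S}"
  have scale: "r *\<^sub>R d \<in> R" if d: "d \<in> R" and r: "0 \<le> r" for r d
  proof -
    have it: "y + real n *\<^sub>R d \<in> S" if "y \<in> S" for y and n :: nat
    proof (induction n)
      case (Suc n)
      then have "(y + real n *\<^sub>R d) + d \<in> S" using d by (auto simp: R_def)
      then show ?case by (simp add: algebra_simps)
    qed (use that in simp)
    show ?thesis
      unfolding R_def
    proof safe
      fix y assume y: "y \<in> S"
      have "y + (r * t) *\<^sub>R d \<in> S" if "t \<ge> 0" for t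
      proof -
        obtain n where n: "real n > r * t" using reals_Archimedean2 by blast
        have n0: "real n > 0" using n that r by (smt (verit) mult_nonneg_nonneg)
        have eq: "y + (r * t) *\<^sub>R d = (1 - r*t/real n) *\<^sub>R y + (r*t/real n) *\<^sub>R (y + real n *\<^sub>R d)"
          using n0 by (simp add: algebra_simps)
        show ?thesis
          unfolding eq using n n0 that r
          by (intro convexD[OF \<open>convex S\<close> y it[OF y]]) (auto simp: field_simps)
      qed
      from this[of 1] show "y + r *\<^sub>R d \<in> S" by simp
    qed
  qed
  have "convex_cone R"
    unfolding convex_cone_iff using scale by (auto simp: R_def add.assoc[symmetric])
  moreover have "D \<subseteq> R"
    using D recession_direction_translate[OF assms(1,2)] unfolding R_def by fastforce
  ultimately have "convex_cone hull D \<subseteq> R" by (rule hull_minimal[rotated])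
  then show ?thesis using assms unfolding R_def by blast
qed

lemma convex_convex_hull_plus_cone:
  "convex (convex hull V + convex_cone hull E)"
  by (intro convex_set_plus convex_convex_hull convex_convex_cone_hull)

text \<open>By convexity the ray leaves \<open>S\<close> once and for all, so its parameters in
  \<open>S\<close> form a compact set. The last point is not relatively interior: a further step of
  length \<open>e\<close> along \<open>d\<close> would stay in the affine hull and hence in
  \<open>S\<close>.\<close>

lemma chord_endpoint:
  fixes S :: "'a::euclidean_space set"
  assumes S: "closed S" "convex S" "y \<in> S" and d: "d \<noteq> 0" "y + d \<in> affine hull S"
    and t0: "t0 \<ge> 0" "y + t0 *\<^sub>R d \<notin> S"
  obtains s where "s \<ge> 0" "y + s *\<^sub>R d \<in> S" "y + s *\<^sub>R d \<notin> rel_interior S"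
    "\<And>t. t \<ge> 0 \<Longrightarrow> y + t *\<^sub>R d \<in> S \<Longrightarrow> t \<le> s"
proof -
  define I where "I = {t. t \<ge> 0 \<and> y + t *\<^sub>R d \<in> S}"
  have le: "t \<le> t0" if "t \<in> I" for t
  proof (rule ccontr)
    assume "\<not> t \<le> t0"
    then have t: "t > t0" "t > 0" using t0 by auto
    have "y + t0 *\<^sub>R d = (1 - t0/t) *\<^sub>R y + (t0/t) *\<^sub>R (y + t *\<^sub>R d)"
      using t by (simp add: algebra_simps)
    also have "\<dots> \<in> S" using that t t0 S by (intro convexD) (auto simp: I_def)
    finally show False using t0 by simp
  qed
  have "I = {0..t0} \<inter> (\<lambda>t. y + t *\<^sub>R d) -` S" using le by (auto simp: I_def)
  moreover have "closed ((\<lambda>t. y + t *\<^sub>R d) -` S)"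
    by (intro continuous_closed_vimage S(1)) (auto intro!: continuous_intros)
  ultimately have "compact I" by (simp add: compact_Int_closed)
  moreover have "0 \<in> I" using S by (simp add: I_def)
  ultimately obtain s where s: "s \<in> I" "\<And>t. t \<in> I \<Longrightarrow> t \<le> s"
    using compact_attains_sup[of I] by blast
  have "y + s *\<^sub>R d \<notin> rel_interior S"
  proof
    assume "y + s *\<^sub>R d \<in> rel_interior S"
    then obtain e where e: "e > 0" "cball (y + s *\<^sub>R d) e \<inter> affine hull S \<subseteq> S"
      by (auto simp: mem_rel_interior_cball)
    define h where "h = e / norm d"
    have h: "h > 0" using e d by (simp add: h_def)
    have eq: "y + (s + h) *\<^sub>R d = (1 - (s+h)) *\<^sub>R y + (s+h) *\<^sub>R (y + d)"
      by (simp add: algebra_simps)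
    have "y + (s + h) *\<^sub>R d \<in> affine hull S"
      unfolding eq using d S(3) by (intro mem_affine[OF affine_affine_hull]) (auto simp: hull_inc)
    moreover have "y + (s + h) *\<^sub>R d \<in> cball (y + s *\<^sub>R d) e"
      using d e by (simp add: dist_norm algebra_simps h_def)
    ultimately have "s + h \<in> I" using e s h by (auto simp: I_def)
    then show False using s(2)[of "s + h"] h by simp
  qed
  then show ?thesis using s that by (auto simp: I_def)
qed

text \<open>
  Klee's theorem. A relative interior point is moved along a line through it to the relative
  boundary, where a supporting hyperplane cuts out a face of smaller dimension; the line can be
  chosen to meet the set in a segment unless the set is itself a half-line, because otherwise a
  nonzero direction and its opposite would both be recession directions.
\<close>

theorem closed_convex_pointed_decomposition:
  fixes S :: "'a::euclidean_space set"
  assumes "closed S" "convex S" "pointed S" "y \<in> S"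
  shows "y \<in> convex hull {v. v extreme_point_of S} + convex_cone hull {d. extreme_direction_of d S}"
  using assms
proof (induction "nat (aff_dim S)" arbitrary: S y rule: less_induct)
  case less
  define M where "M A = convex hull {v. v extreme_point_of A} +
    convex_cone hull {d. extreme_direction_of d A}" for A :: "'a set"
  have boundary: "x \<in> M S" if x: "x \<in> S" "x \<notin> rel_interior S" for x
  proof -
    obtain a where a: "\<And>y. y \<in> S \<Longrightarrow> a \<bullet> x \<le> a \<bullet> y"
      "\<And>y. y \<in> rel_interior S \<Longrightarrow> a \<bullet> x < a \<bullet> y"
      using supporting_hyperplane_rel_boundary[OF \<open>convex S\<close> x] by metis
    define F where "F = S \<inter> {y. a \<bullet> y = a \<bullet> x}"
    have F: "F face_of S"
      unfolding F_def using a(1) by (intro face_of_Int_supporting_hyperplane_ge less.prems)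
    have "rel_interior S \<noteq> {}" using less.prems rel_interior_eq_empty by blast
    then obtain r where "r \<in> rel_interior S" by blast
    then have "r \<in> S - F" using a(2)[of r] rel_interior_subset[of S] by (auto simp: F_def)
    then have "F \<noteq> S" by blast
    then have "aff_dim F < aff_dim S" by (rule face_of_aff_dim_lt[OF less.prems(2) F])
    moreover have "x \<in> F" using x by (simp add: F_def)
    \<comment> \<open>\<open>nat\<close> sends the dimension -1 of the empty set to 0, so the
      induction measure drops only because \<open>F\<close> is nonempty.\<close>
    then have "0 \<le> aff_dim F" by (metis aff_dim_negative_iff empty_iff not_le)
    ultimately have "x \<in> M F"
      unfolding M_def
      using F \<open>x \<in> F\<close> less.prems
      by (intro less.hyps face_of_imp_closed[OF less.prems(2,1) F] face_of_imp_convex[OF F]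
          pointed_subset[OF less.prems(3) face_of_imp_subset[OF F]]) auto
    moreover have "M F \<subseteq> M S"
      unfolding M_def using extreme_point_of_face[OF F] face_of_trans[OF _ F]
      by (intro set_plus_mono2 hull_mono) (auto simp: extreme_direction_of_def)
    ultimately show ?thesis by blast
  qed
  have "convex (M S)" unfolding M_def by (rule convex_convex_hull_plus_cone)
  define D where "D = {d. y + d \<in> affine hull S}"
  have D_uminus: "- d \<in> D" if "d \<in> D" for d
  proof -
    have "y + - d = 2 *\<^sub>R y + (- 1) *\<^sub>R (y + d)" by (simp add: algebra_simps scaleR_2)
    also have "\<dots> \<in> affine hull S"
      using that less.prems(4) unfolding D_def by (intro mem_affine[OF affine_affine_hull]) (auto simp: hull_inc)
    finally show ?thesis by (simp add: D_def)
  qed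
  define R where "R = {d. \<forall>t\<ge>0. y + t *\<^sub>R d \<in> S}"
  have S_D: "x - y \<in> D" if "x \<in> S" for x using that by (simp add: D_def hull_inc)
  have R_pointed: "d = 0" if "d \<in> R" "- d \<in> R" for d
  proof (rule ccontr)
    assume "d \<noteq> 0"
    moreover have "y + t *\<^sub>R d \<in> S" for t
    proof (cases "t \<ge> 0")
      case False
      then have "y + (- t) *\<^sub>R (- d) \<in> S" using that(2) unfolding R_def by (smt (verit) mem_Collect_eq)
      then show ?thesis by simp
    qed (use that in \<open>auto simp: R_def\<close>)
    ultimately show False using \<open>pointed S\<close> by (auto simp: pointed_def)
  qed
  have "y \<in> M S"
  proof (cases "\<exists>d\<in>D - {0}. d \<notin> R \<and> - d \<notin> R")
    case True
    then obtain d where d: "d \<in> D" "d \<noteq> 0" "d \<notin> R" "- d \<notin> R" by blast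
    obtain s where s: "s \<ge> 0" "y + s *\<^sub>R d \<in> M S"
    proof -
      obtain t0 where t0: "t0 \<ge> 0" "y + t0 *\<^sub>R d \<notin> S" using d by (auto simp: R_def)
      show thesis
        by (rule chord_endpoint[OF less.prems(1,2,4) d(2) _ t0]) (use d that boundary in \<open>auto simp: D_def\<close>)
    qed
    obtain r where r: "r \<ge> 0" "y - r *\<^sub>R d \<in> M S"
    proof -
      obtain t0 where t0: "t0 \<ge> 0" "y + t0 *\<^sub>R (-d) \<notin> S" using d by (auto simp: R_def)
      have "- d \<noteq> 0" using d by simp
      then show thesis
        by (rule chord_endpoint[OF less.prems(1,2,4) _ _ t0])
          (use D_uminus[OF d(1)] that boundary in \<open>auto simp: D_def\<close>)
    qed
    show ?thesis
    proof (cases "s + r = 0")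
      case True
      then have "s = 0" using s r by linarith
      then show ?thesis using s by simp
    next
      case False
      have "y = (r/(s+r)) *\<^sub>R (y + s *\<^sub>R d) + (s/(s+r)) *\<^sub>R (y - r *\<^sub>R d)"
        using False by (simp add: algebra_simps flip: scaleR_add_left add_divide_distrib)
      also have "\<dots> \<in> M S"
        using s r False by (intro convexD[OF \<open>convex (M S)\<close>]) (auto simp flip: add_divide_distrib simp: add.commute)
      finally show ?thesis .
    qed
  next
    case all: False
    show ?thesis
    proof (cases "S = {y}")
      case True
      then have "y extreme_point_of S" by simp
      then have "y + 0 \<in> M S"
        unfolding M_def by (intro set_plus_intro hull_inc convex_cone_hull_contains_0) auto
      then show ?thesis by simp
    next
      case False
      then obtain x where x: "x \<in> S" "x \<noteq> y" using less.prems by auto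
      have "x - y \<in> D" by (rule S_D[OF x(1)])
      obtain d where d: "d \<in> D" "d \<noteq> 0" "d \<in> R"
      proof (cases "x - y \<in> R")
        case True
        then show ?thesis using that x \<open>x - y \<in> D\<close> by auto
      next
        case False
        then have "- (x - y) \<in> R" using all x \<open>x - y \<in> D\<close> by auto
        then show ?thesis using that[of "- (x - y)"] x D_uminus[OF \<open>x - y \<in> D\<close>] by auto
      qed
      have closed_R: "closed R"
      proof -
        have "R = (\<Inter>t\<in>{0..}. (\<lambda>d. y + t *\<^sub>R d) -` S)" by (auto simp: R_def)
        also have "closed \<dots>"
          by (intro closed_INT ballI continuous_closed_vimage less.prems) (auto intro!: continuous_intros)
        finally show ?thesis .
      qed
      have parallel_R: "\<exists>\<mu>. e = \<mu> *\<^sub>R d" if e: "e \<in> R" "e \<in> D" for e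
      proof -
        have convex_D: "convex D"
        proof -
          have "D = (\<lambda>x. - y + x) ` (affine hull S)" by (force simp: D_def image_iff)
          then show ?thesis by (simp add: convex_translation affine_imp_convex)
        qed
        \<comment> \<open>The closed sets R and -R cover \<open>D\<close> and share only 0. The
          segment from \<open>e\<close> in R to \<open>- d\<close> in -R is connected, so it passes
          through 0, which makes \<open>e\<close> a multiple of \<open>d\<close>.\<close>
        have "closed_segment e (- d) \<subseteq> D"
          using convex_D e(2) D_uminus[OF d(1)] closed_segment_subset by blast
        then have sub: "closed_segment e (- d) \<subseteq> R \<union> uminus ` R \<or> 0 \<in> closed_segment e (- d)"
          using all by (auto simp: image_iff) (metis DiffI Diff_iff add.inverse_inverse singletonD subsetD)
        have "0 \<in> closed_segment e (- d)"
        proof (rule ccontr)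
          assume n: "0 \<notin> closed_segment e (- d)"
          have "R \<inter> closed_segment e (- d) \<noteq> {}" using e by auto
          moreover have "uminus ` R \<inter> closed_segment e (- d) \<noteq> {}" using d by auto
          moreover have "closed (uminus ` R)" using closed_R by (rule closed_negations)
          ultimately have "R \<inter> uminus ` R \<inter> closed_segment e (- d) \<noteq> {}"
            using sub n closed_R connected_closedD[OF connected_segment(1)] by metis
          then obtain f where f: "f \<in> R" "f \<in> uminus ` R" "f \<in> closed_segment e (- d)" by blast
          then have "- f \<in> R" by auto
          then have "f = 0" by (rule R_pointed[OF f(1)])
          then show False using f(3) n by simp
        qed
        then obtain l where l: "0 \<le> l" "l \<le> 1" "0 = (1 - l) *\<^sub>R e + l *\<^sub>R (- d)"
          by (auto simp: in_segment)
        then have "l \<noteq> 1" using d by auto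
        have "(1 - l) *\<^sub>R e = l *\<^sub>R d" using l by simp
        then have "e = (l / (1 - l)) *\<^sub>R d"
          using \<open>l \<noteq> 1\<close> scaleR_left_imp_eq[of "1 - l" e "(l / (1 - l)) *\<^sub>R d"] by simp
        then show ?thesis by blast
      qed
      have parallel: "\<exists>\<mu>. e = \<mu> *\<^sub>R d" if e: "e \<in> D" for e
      proof (cases "e \<in> R")
        case True
        then show ?thesis using parallel_R e by blast
      next
        case False
        then have "- e \<in> R" using all e by (cases "e = 0") (auto simp: R_def less.prems)
        then obtain \<mu> where "- e = \<mu> *\<^sub>R d" using parallel_R D_uminus[OF e] by blast
        then have "e = (- \<mu>) *\<^sub>R d" by (metis minus_minus scaleR_minus_left)
        then show ?thesis by blast
      qed
      have "- d \<notin> R" using R_pointed d by blast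
      then obtain t0 where t0: "t0 \<ge> 0" "y + t0 *\<^sub>R (-d) \<notin> S" by (auto simp: R_def)
      have "- d \<noteq> 0" "y + - d \<in> affine hull S" using d D_uminus[of d] by (auto simp: D_def)
      then obtain s where s: "s \<ge> 0" "y + s *\<^sub>R (- d) \<in> S" "y + s *\<^sub>R (- d) \<notin> rel_interior S"
        "\<And>t. t \<ge> 0 \<Longrightarrow> y + t *\<^sub>R (- d) \<in> S \<Longrightarrow> t \<le> s"
        using chord_endpoint[OF less.prems(1,2,4) _ _ t0] by metis
      define v where "v = y - s *\<^sub>R d"
      have "v \<in> M S" using boundary s by (simp add: v_def)
      have "S = {v + t *\<^sub>R d |t. t \<ge> 0}"
      proof safe
        fix z assume z: "z \<in> S"
        obtain \<mu> where \<mu>: "z - y = \<mu> *\<^sub>R d" using parallel S_D[OF z] by blast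
        have "- \<mu> \<le> s"
        proof (cases "\<mu> \<ge> 0")
          case False
          moreover have "y + (- \<mu>) *\<^sub>R (- d) = z" using \<mu> by (simp add: algebra_simps)
          ultimately show ?thesis using s(4)[of "- \<mu>"] z by simp
        qed (use s in simp)
        then have "z = v + (\<mu> + s) *\<^sub>R d" "\<mu> + s \<ge> 0"
          using \<mu> by (auto simp: v_def algebra_simps)
        then show "\<exists>t. z = v + t *\<^sub>R d \<and> 0 \<le> t" by blast
      next
        fix t :: real assume t: "t \<ge> 0"
        have "v + t *\<^sub>R d \<in> S" if "t \<ge> s"
        proof -
          have "v + t *\<^sub>R d = y + (t - s) *\<^sub>R d" by (simp add: v_def algebra_simps)
          also have "\<dots> \<in> S" using d(3) that by (auto simp: R_def)
          finally show ?thesis .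
        qed
        moreover have "v + t *\<^sub>R d \<in> S" if "t < s"
        proof -
          have "v + t *\<^sub>R d = (1 - t/s) *\<^sub>R (y + s *\<^sub>R (- d)) + (t/s) *\<^sub>R y"
            using t that by (simp add: v_def algebra_simps)
          also have "\<dots> \<in> S"
            using t that s less.prems by (intro convexD[OF less.prems(2)]) auto
          finally show ?thesis .
        qed
        ultimately show "v + t *\<^sub>R d \<in> S" by linarith
      qed
      then have "{v + t *\<^sub>R d |t. t \<ge> 0} face_of S"
        using face_of_refl[OF less.prems(2)] by simp
      with d(2) have "extreme_direction_of d S" by (rule extreme_direction_ofI)
      obtain p q where pq: "v = p + q" "p \<in> convex hull {v. v extreme_point_of S}"
        "q \<in> convex_cone hull {d. extreme_direction_of d S}"
        using \<open>v \<in> M S\<close> unfolding M_def by (auto elim: set_plus_elim)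
      have "q + s *\<^sub>R d \<in> convex_cone hull {d. extreme_direction_of d S}"
        using pq(3) s(1) \<open>extreme_direction_of d S\<close>
        by (intro convex_cone_hull_add convex_cone_hull_mul) (auto simp: hull_inc)
      then have "p + (q + s *\<^sub>R d) \<in> M S" unfolding M_def using pq(2) by blast
      moreover have "p + (q + s *\<^sub>R d) = y" using pq(1) by (simp add: v_def algebra_simps)
      ultimately show ?thesis by simp
    qed
  qed
  then show ?case by (simp add: M_def)
qed

text \<open>Lets one direction vector per half-line face suffice. At the points
  \<open>v + real n *\<^sub>R d\<close> the parameter \<open>f n\<close> is affine in
  \<open>n\<close> and never negative, so its slope is nonnegative.\<close>

lemma half_line_direction_unique:
  fixes d e :: "'a::real_normed_vector"
  assumes eq: "{v + t *\<^sub>R d |t::real. t \<ge> 0} = {w + t *\<^sub>R e |t::real. t \<ge> 0}"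
  shows "\<exists>r\<ge>0. d = r *\<^sub>R e"
proof (cases "e = 0")
  case True
  have "v + 0 *\<^sub>R d \<in> {v + t *\<^sub>R d |t::real. t \<ge> 0}" "v + 1 *\<^sub>R d \<in> {v + t *\<^sub>R d |t::real. t \<ge> 0}"
    by (blast intro: zero_le_one order_refl)+
  then have "v + d = w" "v = w" unfolding eq using True by auto
  then show ?thesis by auto
next
  case False
  have "\<exists>t\<ge>0. v + real n *\<^sub>R d = w + t *\<^sub>R e" for n :: nat
  proof -
    have "v + real n *\<^sub>R d \<in> {v + t *\<^sub>R d |t::real. t \<ge> 0}" using of_nat_0_le_iff by blast
    then show ?thesis unfolding eq by auto
  qed
  then obtain f where f: "\<And>n. f n \<ge> 0" "\<And>n. v + real n *\<^sub>R d = w + f n *\<^sub>R e" by metis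
  have d: "d = (f 1 - f 0) *\<^sub>R e" using f(2)[of 0] f(2)[of 1] by (simp add: algebra_simps)
  have "real n * (f 1 - f 0) + f 0 = f n" for n
  proof -
    have "w + f n *\<^sub>R e = w + (f 0 + real n * (f 1 - f 0)) *\<^sub>R e"
      using f(2)[of 0] f(2)[of n] d by (simp add: algebra_simps)
    then show ?thesis using False by simp
  qed
  then have ge: "real n * (f 1 - f 0) + f 0 \<ge> 0" for n using f(1) by metis
  have "f 1 - f 0 \<ge> 0"
  proof (rule ccontr)
    assume "\<not> ?thesis"
    then obtain n where "real n * (f 0 - f 1) > f 0" using reals_Archimedean3[of "f 0 - f 1"] by auto
    then show False using ge[of n] by (simp add: algebra_simps)
  qed
  then show ?thesis using d by blast
qed

text \<open>Extreme directions are closed under positive scaling, so there may be infinitely many.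
  \<open>dir\<close> picks one for each half-line face, and a polyhedron has finitely many
  faces.\<close>

theorem pointed_polyhedron_minimal_V_representation:
  fixes S :: "'a::euclidean_space set"
  assumes "polyhedron S" "pointed S"
  shows "\<exists>V E. minimal_V_representation S V E"
proof -
  have S: "closed S" "convex S" using assms polyhedron_imp_closed polyhedron_imp_convex by auto
  define V where "V = {v. v extreme_point_of S}"
  define dir where "dir F = (SOME d. d \<noteq> 0 \<and> (\<exists>v. {v + t *\<^sub>R d |t::real. t \<ge> 0} = F))" for F :: "'a set"
  define \<H> where "\<H> = {F. F face_of S \<and> (\<exists>d v. d \<noteq> 0 \<and> {v + t *\<^sub>R d |t::real. t \<ge> 0} = F)}"
  define E where "E = dir ` \<H>"
  have dir: "dir F \<noteq> 0 \<and> (\<exists>v. {v + t *\<^sub>R dir F |t::real. t \<ge> 0} = F)" if "F \<in> \<H>" for F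
    unfolding dir_def by (rule someI_ex) (use that in \<open>auto simp: \<H>_def\<close>)
  have "finite V" unfolding V_def by (rule finite_polyhedron_extreme_points[OF assms(1)])
  moreover have "finite E"
    unfolding E_def
    by (intro finite_imageI finite_subset[OF _ finite_polyhedron_faces[OF assms(1)]]) (auto simp: \<H>_def)
  moreover have E_ext: "extreme_direction_of d S" if d: "d \<in> E" for d
  proof -
    obtain F where F: "F \<in> \<H>" "d = dir F" using d by (auto simp: E_def)
    then obtain v where "d \<noteq> 0" "{v + t *\<^sub>R d |t::real. t \<ge> 0} = F" using dir by blast
    moreover have "F face_of S" using F(1) by (simp add: \<H>_def)
    ultimately show ?thesis using extreme_direction_ofI[of d v S] by simp
  qed
  moreover have "0 \<notin> E" using dir unfolding E_def by fastforce
  moreover have "S = convex hull V + convex_cone hull E"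
  proof
    have "extreme_direction_of d S \<Longrightarrow> d \<in> convex_cone hull E" for d
    proof -
      assume "extreme_direction_of d S"
      then obtain v F where d: "d \<noteq> 0" and F: "F face_of S" "{v + t *\<^sub>R d |t::real. t \<ge> 0} = F"
        by (auto simp: extreme_direction_of_def)
      have "F \<in> \<H>" using d F unfolding \<H>_def by blast
      then obtain w where "{w + t *\<^sub>R dir F |t::real. t \<ge> 0} = F" using dir by blast
      then obtain r where "r \<ge> 0" "d = r *\<^sub>R dir F"
        using half_line_direction_unique[of v d w "dir F"] F(2) by auto
      then show "d \<in> convex_cone hull E"
        using \<open>F \<in> \<H>\<close> by (simp add: E_def convex_cone_hull_mul hull_inc)
    qed
    then have "convex_cone hull {d. extreme_direction_of d S} \<subseteq> convex_cone hull E"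
      by (intro hull_minimal convex_cone_convex_cone_hull) auto
    then show "S \<subseteq> convex hull V + convex_cone hull E"
      using closed_convex_pointed_decomposition[OF S assms(2)] set_plus_mono2[OF subset_refl]
      unfolding V_def by (meson subsetI subsetD)
    have "convex hull V \<subseteq> S"
      using S(2) by (intro hull_minimal) (auto simp: V_def extreme_point_of_def)
    moreover have "\<exists>v. \<forall>t\<ge>0. v + t *\<^sub>R d \<in> S" if "d \<in> E" for d
      using E_ext[OF that] unfolding extreme_direction_of_def by (blast intro: half_line_face_mem)
    then have "y + d \<in> S" if "d \<in> convex_cone hull E" "y \<in> S" for d y
      using recession_convex_cone_hull[OF S _ that] by blast
    ultimately show "convex hull V + convex_cone hull E \<subseteq> S" by (auto elim!: set_plus_elim)
  qed
  moreover have "\<forall>v\<in>V. v extreme_point_of S" by (simp add: V_def)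
  ultimately have "minimal_V_representation S V E"
    unfolding minimal_V_representation_def V_representation_def by (intro conjI ballI) blast+
  then show ?thesis by blast
qed

section \<open>Finitely generated cones\<close>

text \<open>Closed cones may lose closedness under linear maps; finitely generated ones keep it,
  which is what attainment and Farkas' lemma rest on.\<close>

definition finitely_generated_cone :: "'a::real_vector set \<Rightarrow> bool" where
  "finitely_generated_cone K \<longleftrightarrow> (\<exists>S. finite S \<and> K = convex_cone hull S)"

lemma finitely_generated_coneI: "finite S \<Longrightarrow> finitely_generated_cone (convex_cone hull S)"
  unfolding finitely_generated_cone_def by blast

lemma finitely_generated_cone_imp_closed:
  fixes K :: "'a::euclidean_space set"
  shows "finitely_generated_cone K \<Longrightarrow> closed K"
  unfolding finitely_generated_cone_def using closed_convex_cone_hull by blast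

lemma finitely_generated_cone_imp_convex_cone: "finitely_generated_cone K \<Longrightarrow> convex_cone K"
  unfolding finitely_generated_cone_def using convex_cone_convex_cone_hull by blast

lemma finitely_generated_cone_imp_convex: "finitely_generated_cone K \<Longrightarrow> convex K"
  unfolding finitely_generated_cone_def using convex_convex_cone_hull by blast

lemma finitely_generated_cone_linear_image:
  assumes "linear f" "finitely_generated_cone K"
  shows "finitely_generated_cone (f ` K)"
  using assms convex_cone_hull_linear_image[OF assms(1)]
  unfolding finitely_generated_cone_def by (metis finite_imageI)

lemma finitely_generated_cone_Times:
  assumes "finitely_generated_cone K" "finitely_generated_cone L"
  shows "finitely_generated_cone (K \<times> L)"
proof -
  obtain S T where S: "finite S" "K = convex_cone hull S" and T: "finite T" "L = convex_cone hull T"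
    using assms by (auto simp: finitely_generated_cone_def)
  have "convex_cone hull ((\<lambda>x. (x, 0)) ` S \<union> Pair 0 ` T) = K \<times> L"
  proof
    show "convex_cone hull ((\<lambda>x. (x, 0)) ` S \<union> Pair 0 ` T) \<subseteq> K \<times> L"
      using S(2) T(2)
      by (intro hull_minimal convex_cone_Times)
        (auto simp: hull_inc convex_cone_convex_cone_hull convex_cone_hull_contains_0)
    have lin: "linear (\<lambda>x::'a. (x, 0::'b))" "linear (Pair (0::'a) :: 'b \<Rightarrow> _)"
      by (auto intro!: linearI)
    then have eq: "(\<lambda>x. (x, 0::'b)) ` K = convex_cone hull ((\<lambda>x. (x, 0)) ` S)"
      "Pair (0::'a) ` L = convex_cone hull (Pair 0 ` T)"
      using convex_cone_hull_linear_image[OF lin(1), of S] convex_cone_hull_linear_image[OF lin(2), of T] S T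
      by simp_all
    show "K \<times> L \<subseteq> convex_cone hull ((\<lambda>x. (x, 0)) ` S \<union> Pair 0 ` T)"
    proof (clarify, goal_cases)
      case (1 a b)
      then have "(a, 0::'b) \<in> convex_cone hull ((\<lambda>x. (x, 0)) ` S)"
        "(0::'a, b) \<in> convex_cone hull (Pair 0 ` T)"
        using eq imageI[OF 1(1), of "\<lambda>x. (x, 0::'b)"] imageI[OF 1(2), of "Pair (0::'a)"] by simp_all
      then have "(a, 0) \<in> convex_cone hull ((\<lambda>x. (x, 0)) ` S \<union> Pair 0 ` T)"
        "(0, b) \<in> convex_cone hull ((\<lambda>x. (x, 0)) ` S \<union> Pair 0 ` T)"
        using hull_mono[of _ "(\<lambda>x. (x, 0)) ` S \<union> Pair 0 ` T"] by blast+
      from convex_cone_hull_add[OF this] show ?case by simp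
    qed
  qed
  then show ?thesis using S(1) T(1) finitely_generated_coneI by (metis finite_UnI finite_imageI)
qed

lemma convex_cone_sum:
  assumes "convex_cone K" "\<And>i. i \<in> I \<Longrightarrow> f i \<in> K"
  shows "sum f I \<in> K"
  using assms(2)
proof (induction I rule: infinite_finite_induct)
  case (insert i I)
  then show ?case using convex_cone_add[OF assms(1)] by simp
qed (use convex_cone_contains_0[OF assms(1)] in simp_all)

lemma finitely_generated_cone_UNIV: "finitely_generated_cone (UNIV :: 'a::euclidean_space set)"
proof -
  define H where "H = convex_cone hull (Basis \<union> uminus ` Basis :: 'a set)"
  have "x \<in> H" for x :: 'a
  proof -
    have "(x \<bullet> i) *\<^sub>R i \<in> H" if i: "i \<in> Basis" for i
    proof (cases "x \<bullet> i \<ge> 0")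
      case True
      then show ?thesis unfolding H_def using i by (intro convex_cone_hull_mul hull_inc) auto
    next
      case False
      then have "(- (x \<bullet> i)) *\<^sub>R (- i) \<in> H"
        unfolding H_def using i by (intro convex_cone_hull_mul hull_inc) auto
      then show ?thesis by simp
    qed
    then have "(\<Sum>i\<in>Basis. (x \<bullet> i) *\<^sub>R i) \<in> H"
      unfolding H_def by (intro convex_cone_sum convex_cone_convex_cone_hull)
    then show ?thesis by (simp add: euclidean_representation)
  qed
  then have "UNIV = H" by blast
  then show ?thesis unfolding H_def by (metis finitely_generated_coneI finite_Basis finite_UnI finite_imageI)
qed

lemma finitely_generated_cone_orthant: "finitely_generated_cone {u::real^'m. u \<ge> 0}"
proof -
  have "{u::real^'m. u \<ge> 0} = convex_cone hull (range (\<lambda>i. axis i 1))"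
  proof
    show "{u::real^'m. u \<ge> 0} \<subseteq> convex_cone hull (range (\<lambda>i. axis i 1))"
    proof
      fix u :: "real^'m" assume "u \<in> {u. u \<ge> 0}"
      then have "(\<Sum>i\<in>UNIV. (u $ i) *\<^sub>R axis i 1) \<in> convex_cone hull (range (\<lambda>i. axis i (1::real)))"
        by (intro convex_cone_sum convex_cone_hull_mul hull_inc convex_cone_convex_cone_hull)
          (auto simp: less_eq_vec_def)
      moreover have "(\<Sum>i\<in>UNIV. (u $ i) *\<^sub>R axis i 1) = u"
        using basis_expansion[of u] by (simp add: scalar_mult_eq_scaleR)
      ultimately show "u \<in> convex_cone hull (range (\<lambda>i. axis i 1))" by simp
    qed
    show "convex_cone hull (range (\<lambda>i. axis i 1)) \<subseteq> {u::real^'m. u \<ge> 0}"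
      by (intro hull_minimal) (auto simp: convex_cone_iff less_eq_vec_def axis_def)
  qed
  then show ?thesis by (simp add: finitely_generated_coneI)
qed

lemma finitely_generated_cone_nonneg: "finitely_generated_cone {r::real. r \<ge> 0}"
proof -
  have "{r::real. r \<ge> 0} = convex_cone hull {1}"
  proof
    show "{r::real. r \<ge> 0} \<subseteq> convex_cone hull {1}"
      using convex_cone_hull_mul[of 1 "{1::real}"] by (auto simp: hull_inc)
    show "convex_cone hull {1} \<subseteq> {r::real. r \<ge> 0}"
      by (intro hull_minimal) (auto simp: convex_cone_iff)
  qed
  then show ?thesis by (simp add: finitely_generated_coneI)
qed

text \<open>The range of values is closed because it is a section of a finitely generated cone.\<close>

lemma conic_linear_program_attained:
  fixes f :: "'a::euclidean_space \<Rightarrow> 'b::euclidean_space" and g :: "'a \<Rightarrow> real"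
  assumes "finitely_generated_cone K" "linear f" "linear g"
    and feasible: "x0 \<in> K" "f x0 = d" and bound: "\<And>x. x \<in> K \<Longrightarrow> f x = d \<Longrightarrow> g x \<le> M"
  shows "\<exists>x\<in>K. f x = d \<and> (\<forall>x'\<in>K. f x' = d \<longrightarrow> g x' \<le> g x)"
proof -
  define V where "V = {g x |x. x \<in> K \<and> f x = d}"
  \<comment> \<open>The slack \<open>r\<close> turns the section of \<open>L\<close> over
    \<open>d\<close> into the set of all reals that are at most some attained value. It contains the
    supremum, which is therefore attained.\<close>
  define h where "h = (\<lambda>(x, r::real). (f x, g x - r))"
  define L where "L = h ` (K \<times> {r. r \<ge> 0})"
  have "linear h"
    unfolding h_def using linear_add[OF assms(2)] linear_add[OF assms(3)]
      linear_scale[OF assms(2)] linear_scale[OF assms(3)]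
    by (intro linearI) (auto simp: algebra_simps)
  then have "closed L"
    unfolding L_def
    by (intro finitely_generated_cone_imp_closed finitely_generated_cone_linear_image
        finitely_generated_cone_Times finitely_generated_cone_nonneg assms)
  have V: "V \<noteq> {}" "bdd_above V" using feasible bound by (auto simp: V_def intro!: bdd_aboveI)
  have "V \<subseteq> Pair d -` L"
    unfolding V_def
  proof clarsimp
    fix x assume "x \<in> K"
    then have "h (x, 0) \<in> L" unfolding L_def by blast
    then show "(f x, g x) \<in> L" by (simp add: h_def)
  qed
  moreover have "closed (Pair d -` L)"
    by (intro continuous_closed_vimage \<open>closed L\<close>) (auto intro!: continuous_intros)
  ultimately have "closure V \<subseteq> Pair d -` L" by (rule closure_minimal)
  then have "(d, Sup V) \<in> L" using closure_contains_Sup[OF V] by blast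
  then obtain x where x: "x \<in> K" "f x = d" "Sup V \<le> g x" unfolding L_def h_def by auto
  have "g x' \<le> g x" if "x' \<in> K" "f x' = d" for x'
    using cSup_upper[OF _ V(2), of "g x'"] that x(3) unfolding V_def by force
  then show ?thesis using x by blast
qed

section \<open>Dual cones, separation and nonnegative vectors\<close>

lemma dual_cone_convex_cone_hull: "dual_cone (convex_cone hull S) = {w. \<forall>y\<in>S. w \<bullet> y \<ge> 0}"
proof -
  have "convex_cone hull S \<subseteq> {y. w \<bullet> y \<ge> 0}" if "\<forall>y\<in>S. w \<bullet> y \<ge> 0" for w
    using that by (intro hull_minimal convex_cone_halfspace_ge) auto
  moreover have "y \<in> convex_cone hull S" if "y \<in> S" for y using that by (rule hull_inc)
  ultimately show ?thesis unfolding dual_cone_def by fast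
qed

lemma transpose_mult_nonneg_iff:
  fixes Y :: "real^'k^'q"
  shows "transpose Y *v w \<ge> 0 \<longleftrightarrow> w \<in> dual_cone (convex_cone hull (columns Y))"
proof -
  have "(transpose Y *v w) $ j = w \<bullet> column j Y" for j
    by (simp add: matrix_vector_mult_def transpose_def inner_vec_def column_def mult.commute)
  then show ?thesis
    by (auto simp: dual_cone_convex_cone_hull less_eq_vec_def columns_def)
qed

lemma separating_closed_convex_cone:
  fixes K :: "'a::euclidean_space set"
  assumes "closed K" "convex_cone K" "z \<notin> K"
  obtains a where "a \<in> dual_cone K" "a \<bullet> z < 0"
proof -
  obtain a \<beta> where a: "a \<bullet> z < \<beta>" "\<And>x. x \<in> K \<Longrightarrow> a \<bullet> x > \<beta>"
    using separating_hyperplane_closed_point[of K z] assms by (auto simp: convex_cone_def)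
  have "\<beta> < 0" using a(2)[OF convex_cone_contains_0[OF assms(2)]] by simp
  have "a \<bullet> x \<ge> 0" if "x \<in> K" for x
  proof (rule ccontr)
    assume n: "\<not> ?thesis"
    \<comment> \<open>Scaled so that its inner product with \<open>a\<close> is exactly
      \<open>\<beta>\<close>, which strict separation forbids.\<close>
    have "(\<beta> / (a \<bullet> x)) *\<^sub>R x \<in> K"
      using n \<open>\<beta> < 0\<close> that by (intro convex_cone_scaleR[OF assms(2)]) (auto simp: field_simps)
    from a(2)[OF this] show False using n by simp
  qed
  then show ?thesis using that a \<open>\<beta> < 0\<close> by (fastforce simp: dual_cone_def)
qed

lemma dual_cone_dual_cone:
  fixes K :: "'a::euclidean_space set"
  assumes "closed K" "convex_cone K"
  shows "dual_cone (dual_cone K) = K"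
proof
  show "dual_cone (dual_cone K) \<subseteq> K"
  proof
    fix z assume z: "z \<in> dual_cone (dual_cone K)"
    show "z \<in> K"
    proof (rule ccontr)
      assume "z \<notin> K"
      then obtain a where "a \<in> dual_cone K" "a \<bullet> z < 0"
        by (rule separating_closed_convex_cone[OF assms])
      moreover have "z \<bullet> a \<ge> 0"
        using z \<open>a \<in> dual_cone K\<close> unfolding dual_cone_def[of "dual_cone K"] by blast
      ultimately show False by (simp add: inner_commute)
    qed
  qed
qed (auto simp: dual_cone_def inner_commute)

text \<open>As a simp rule it would replace \<open>transpose A *v u\<close> by
  \<open>u v* A\<close>, a form in which the dual constraints are not stated.\<close>

declare transpose_matrix_vector [simp del]

lemma inner_nonneg_vec:
  fixes u s :: "real^'m"
  shows "u \<ge> 0 \<Longrightarrow> s \<ge> 0 \<Longrightarrow> u \<bullet> s \<ge> 0"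
  by (auto simp: inner_vec_def less_eq_vec_def intro!: sum_nonneg)

lemma nonneg_vec_iff_inner:
  fixes u :: "real^'m"
  shows "u \<ge> 0 \<longleftrightarrow> (\<forall>s\<ge>0. u \<bullet> s \<ge> 0)"
proof
  assume *: "\<forall>s\<ge>0. u \<bullet> s \<ge> 0"
  have "u \<bullet> axis i 1 \<ge> 0" for i
    using * by (auto simp: less_eq_vec_def axis_def)
  then show "u \<ge> 0" by (simp add: inner_axis less_eq_vec_def)
qed (use inner_nonneg_vec in blast)

lemma inner_transpose_mult:
  fixes A :: "real^'n^'m"
  shows "(transpose A *v u) \<bullet> x = u \<bullet> (A *v x)"
  by (simp add: transpose_matrix_vector dot_lmul_matrix)

lemma transpose_mult_eq_iff:
  fixes A :: "real^'n^'m" and D :: "real^'n^'k"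
  shows "transpose A *v u = transpose D *v w \<longleftrightarrow> (\<forall>x. u \<bullet> (A *v x) = w \<bullet> (D *v x))"
  by (subst vector_eq_rdot[symmetric]) (simp only: inner_transpose_mult)

lemma finite_columns: "finite (columns (A :: real^'n^'m))"
  by (simp add: columns_def full_SetCompr_eq)

text \<open>In a vanishing inner product of nonnegative vectors every term vanishes, so only the
  positions of the zeros of \<open>s\<close> matter. This is the coordinate form of complementary
  slackness.\<close>

lemma inner_zero_transfer:
  fixes u s s' :: "real^'m"
  assumes "u \<ge> 0" "s \<ge> 0" "u \<bullet> s = 0" "\<And>i. s $ i = 0 \<Longrightarrow> s' $ i = 0"
  shows "u \<bullet> s' = 0"
proof -
  have "(\<Sum>i\<in>UNIV. u $ i * s $ i) = 0" using assms(3) by (simp add: inner_vec_def)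
  then have "u $ i * s $ i = 0" for i
    using assms(1,2) by (subst (asm) sum_nonneg_eq_0_iff) (auto simp: less_eq_vec_def)
  then have "u $ i * s' $ i = 0" for i using assms(4)[of i] by (metis mult_eq_0_iff)
  then show ?thesis unfolding inner_vec_def inner_real_def by (intro sum.neutral) blast
qed

lemma convex_cone_hull_columnsE:
  fixes Z :: "real^'l^'q"
  assumes "w \<in> convex_cone hull (columns Z)"
  obtains v where "v \<ge> 0" "w = Z *v v"
proof -
  have "convex_cone hull (columns Z) \<subseteq> (*v) Z ` {v. v \<ge> 0}"
  proof (rule hull_minimal)
    show "columns Z \<subseteq> (*v) Z ` {v. v \<ge> 0}"
    proof
      fix y assume "y \<in> columns Z"
      then obtain j where "y = column j Z" by (auto simp: columns_def)
      then have "y = Z *v axis j 1" by (simp add: matrix_vector_mult_basis)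
      moreover have "axis j 1 \<in> {v::real^'l. v \<ge> 0}" by (auto simp: less_eq_vec_def axis_def)
      ultimately show "y \<in> (*v) Z ` {v. v \<ge> 0}" by blast
    qed
    show "convex_cone ((*v) Z ` {v. v \<ge> 0})"
      by (intro convex_cone_linear_image conjI matrix_vector_mul_linear
          finitely_generated_cone_imp_convex_cone finitely_generated_cone_orthant)
  qed
  then show ?thesis using assms that by blast
qed

lemma closed_convex_hull_plus_cone:
  fixes F E :: "'a::euclidean_space set"
  assumes "finite F" "finite E"
  shows "closed (convex hull F + convex_cone hull E)"
proof -
  have "convex hull F + convex_cone hull E =
    (\<Union>x\<in>convex hull F. \<Union>y\<in>convex_cone hull E. {x + y})"
    by (auto simp: set_plus_def)
  then show ?thesis
    using compact_closed_sums[OF finite_imp_compact_convex_hull[OF assms(1)] closed_convex_cone_hull[OF assms(2)]]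
    by simp
qed

section \<open>The coupling function\<close>

lemma coupling_eq_inner:
  fixes c :: "real^'q::{finite,linorder}"
  shows "coupling c y y' =
    (\<chi> i. if i = last_index then - 1 else y $ i - y $ last_index * c $ i) \<bullet> y' + y $ last_index"
proof -
  have "(\<chi> i. if i = last_index then - 1 else y $ i - y $ last_index * c $ i) \<bullet> y' =
     (\<Sum>i\<in>UNIV. (if i = last_index then - 1 else y $ i - y $ last_index * c $ i) * y' $ i)"
    by (simp add: inner_vec_def)
  also have "\<dots> = - y' $ last_index + (\<Sum>i\<in>UNIV - {last_index}. (y $ i - y $ last_index * c $ i) * y' $ i)"
    by (subst sum.remove[of _ last_index]) auto
  also have "(\<Sum>i\<in>UNIV - {last_index}. (y $ i - y $ last_index * c $ i) * y' $ i) =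
     (\<Sum>i\<in>UNIV - {last_index}. y $ i * y' $ i) - y $ last_index * (\<Sum>i\<in>UNIV - {last_index}. c $ i * y' $ i)"
    by (simp add: algebra_simps sum_subtractf sum_distrib_left)
  finally show ?thesis by (simp add: coupling_def algebra_simps)
qed

text \<open>The normalization recovers the coordinate of \<open>w\<close> that
  \<open>dual_obj\<close> overwrites: as \<open>c\<close> has last entry 1, it is 1 minus the sum
  over the other coordinates. Nonnegative coupling thus means the inequality with normal
  \<open>w\<close> and bound \<open>b \<bullet> u\<close>.\<close>

lemma coupling_dual_obj:
  fixes c :: "real^'q::{finite,linorder}"
  assumes "c $ last_index = 1" "c \<bullet> w = 1"
  shows "coupling c y (dual_obj b (u, w)) = w \<bullet> y - b \<bullet> u"
proof -
  define \<sigma> where "\<sigma> = (\<Sum>i\<in>UNIV - {last_index}. c $ i * w $ i)"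
  have "c \<bullet> w = w $ last_index + (\<Sum>i\<in>UNIV - {last_index}. c $ i * w $ i)"
    unfolding inner_vec_def using assms(1) by (subst sum.remove[of _ last_index]) auto
  then have "\<sigma> = 1 - w $ last_index" using assms(2) by (simp add: \<sigma>_def)
  then have "y $ last_index * \<sigma> = y $ last_index - w $ last_index * y $ last_index"
    by (simp only: right_diff_distrib mult_1_right mult.commute)
  moreover have "w \<bullet> y = w $ last_index * y $ last_index + (\<Sum>i\<in>UNIV - {last_index}. y $ i * w $ i)"
    unfolding inner_vec_def by (subst sum.remove[of _ last_index]) (auto intro!: sum.cong)
  ultimately show ?thesis
    by (simp add: coupling_def dual_obj_def algebra_simps flip: \<sigma>_def)
qed

text \<open>Converse of \<open>coupling_eq_inner\<close> up to scaling: \<open>\<kappa>\<close>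
  makes the last coefficient -1, the constant term becomes the last entry of \<open>y\<close>, and
  the summand with \<open>c\<close> undoes the subtraction in the gradient.\<close>

lemma affine_eq_coupling:
  fixes c a :: "real^'q::{finite,linorder}"
  assumes "a $ last_index < 0" "c $ last_index = 1"
  shows "\<exists>\<kappa>>0. \<exists>y. \<forall>x. coupling c y x = \<kappa> * (a \<bullet> x + r)"
proof -
  define \<kappa> where "\<kappa> = - 1 / a $ last_index"
  define y where "y = (\<chi> i. if i = last_index then \<kappa> * r else \<kappa> * a $ i + \<kappa> * r * c $ i)"
  have "(\<chi> i. if i = last_index then - 1 else y $ i - y $ last_index * c $ i) = \<kappa> *\<^sub>R a"
    using assms by (auto simp: vec_eq_iff y_def \<kappa>_def)
  then have "coupling c y x = \<kappa> * (a \<bullet> x + r)" for x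
    unfolding coupling_eq_inner by (simp add: algebra_simps) (simp add: y_def)
  moreover have "\<kappa> > 0" using assms by (simp add: \<kappa>_def field_simps)
  ultimately show ?thesis by blast
qed

lemma e_last_nth: "e_last $ i = (if i = last_index then 1 else 0)"
  by (simp add: e_last_def axis_def)

lemma inner_e_last: "a \<bullet> e_last = a $ last_index"
  by (simp add: e_last_def inner_axis)

lemma K_cone_uminus: "uminus ` K_cone = convex_cone hull {- e_last}"
proof
  show "uminus ` K_cone \<subseteq> convex_cone hull {- e_last}"
  proof clarify
    fix x :: "real^'q::{finite,linorder}" assume "x \<in> K_cone"
    then obtain t where "t \<ge> 0" "x = t *\<^sub>R e_last" by (auto simp: K_cone_def)
    moreover have "t *\<^sub>R (- e_last) \<in> convex_cone hull {- e_last}" if "t \<ge> 0"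
      using that by (intro convex_cone_hull_mul hull_inc) auto
    ultimately show "- x \<in> convex_cone hull {- e_last}" by simp
  qed
  have "convex_cone (K_cone :: (real^'q::{finite,linorder}) set)"
    unfolding convex_cone_iff K_cone_def
    by (auto simp flip: scaleR_add_left)
  then show "convex_cone hull {- e_last} \<subseteq> uminus ` K_cone"
    by (intro hull_minimal convex_cone_negations) (auto simp: K_cone_def intro!: exI[of _ 1])
qed

text \<open>
  A hyperplane separating \<open>z\<close> from \<open>A\<close> may be vertical; adding the coupling with \<open>y0\<close> to a large
  multiple of its affine function tilts it.
\<close>

lemma coupling_bidual:
  fixes c :: "real^'q::{finite,linorder}"
  assumes c: "c $ last_index = 1" and A: "closed A" "convex A" "A \<noteq> {}"
    and down: "\<And>x. x \<in> A \<Longrightarrow> x - e_last \<in> A"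
    and y0: "\<forall>x\<in>A. coupling c y0 x \<ge> 0"
    and z: "\<forall>y. (\<forall>x\<in>A. coupling c y x \<ge> 0) \<longrightarrow> coupling c y z \<ge> 0"
  shows "z \<in> A"
proof (rule ccontr)
  assume "z \<notin> A"
  then obtain a \<beta> where a: "a \<bullet> z < \<beta>" "\<And>x. x \<in> A \<Longrightarrow> a \<bullet> x > \<beta>"
    using separating_hyperplane_closed_point[OF A(2,1)] by blast
  have a_last: "a $ last_index \<le> 0"
  proof (rule ccontr)
    assume n: "\<not> ?thesis"
    obtain x where "x \<in> A" using A by blast
    have it: "x - real n *\<^sub>R e_last \<in> A" for n
    proof (induction n)
      case (Suc n)
      then show ?case using down[of "x - real n *\<^sub>R e_last"] by (simp add: algebra_simps)
    qed (use \<open>x \<in> A\<close> in simp)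
    obtain n where "real n * a $ last_index > a \<bullet> x - \<beta>"
      using n reals_Archimedean3[of "a $ last_index"] by auto
    then show False using a(2)[OF it[of n]] by (simp add: inner_diff_right inner_e_last)
  qed
  define v where "v = (\<chi> i. if i = last_index then - 1 else y0 $ i - y0 $ last_index * c $ i)"
  have v: "coupling c y0 x = v \<bullet> x + y0 $ last_index" for x by (simp add: coupling_eq_inner v_def)
  \<comment> \<open>Large enough for the separating term to outweigh the coupling with
    \<open>y0\<close> at \<open>z\<close>: their sum there is at most -1.\<close>
  define M where "M = (\<bar>coupling c y0 z\<bar> + 1) / (\<beta> - a \<bullet> z)"
  have M: "M > 0" "M * (\<beta> - a \<bullet> z) = \<bar>coupling c y0 z\<bar> + 1" using a(1) by (auto simp: M_def)
  have "(M *\<^sub>R a + v) $ last_index < 0"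
    using a_last M by (simp add: v_def) (smt (verit) mult_nonneg_nonpos)
  from affine_eq_coupling[OF this c, of "y0 $ last_index - M * \<beta>"]
  obtain \<kappa> y where \<kappa>: "\<kappa> > 0"
    "\<And>x. coupling c y x = \<kappa> * ((M *\<^sub>R a + v) \<bullet> x + (y0 $ last_index - M * \<beta>))" by blast
  have eq: "coupling c y x = \<kappa> * (M * (a \<bullet> x - \<beta>) + coupling c y0 x)" for x
    by (simp add: \<kappa> v algebra_simps)
  have "coupling c y x \<ge> 0" if "x \<in> A" for x
    unfolding eq using \<kappa>(1) M(1) a(2)[OF that] y0 that by simp
  then have "coupling c y z \<ge> 0" using z by blast
  moreover have "M * (a \<bullet> z - \<beta>) + coupling c y0 z < 0"
    using M(2) by (simp add: algebra_simps)
  ultimately show False using \<kappa>(1) by (simp add: eq zero_le_mult_iff)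
qed

lemma linear_dual_obj: "linear (dual_obj b)"
  by (intro linearI; simp add: dual_obj_def split_beta; simp add: vec_eq_iff inner_add_right)

text \<open>Moving along \<open>- e_last\<close> raises the coupling at rate 1 whatever
  \<open>y\<close> is, so the generators in \<open>F\<close> alone decide.\<close>

lemma coupling_nonneg_superset:
  assumes "\<And>x. x \<in> F \<Longrightarrow> coupling c y x \<ge> 0" and "x \<in> convex hull F + convex_cone hull {- e_last}"
  shows "coupling c y x \<ge> 0"
proof -
  define v where "v = (\<chi> i. if i = last_index then - 1 else y $ i - y $ last_index * c $ i)"
  have v: "coupling c y x = v \<bullet> x + y $ last_index" for x by (simp add: coupling_eq_inner v_def)
  obtain p k where x: "x = p + k" and p: "p \<in> convex hull F" and k: "k \<in> convex_cone hull {- e_last}"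
    using assms(2) by (auto elim: set_plus_elim)
  have "convex hull F \<subseteq> {x. v \<bullet> x \<ge> - y $ last_index}"
    using assms(1) by (intro hull_minimal convex_halfspace_ge) (force simp: v)
  moreover have "convex_cone hull {- e_last} \<subseteq> {k. v \<bullet> k \<ge> 0}"
    by (intro hull_minimal convex_cone_halfspace_ge) (simp add: inner_e_last v_def)
  ultimately show ?thesis using p k x unfolding v by (fastforce simp: inner_add_right)
qed

section \<open>Linear programming duality\<close>

locale vector_linear_program =
  fixes B :: "real ^ 'n ^ 'm"
    and b :: "real ^ 'm"
    and P :: "real ^ 'n ^ 'q::{finite,linorder}"
    and C :: "(real ^ 'q::{finite,linorder}) set"
    and c :: "real ^ 'q::{finite,linorder}"
    and Y :: "real ^ 'k ^ 'q::{finite,linorder}"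
    and Z :: "real ^ 'l ^ 'q::{finite,linorder}"
  assumes C_eq: "convex_cone hull (columns Y) = C"
    and dual_C_eq: "convex_cone hull (columns Z) = dual_cone C"
    and c_interior: "c \<in> interior C" and c_last: "c $ last_index = 1"
    and feasible_nonempty: "feasible B b \<noteq> {}"
begin

abbreviation "\<T> \<equiv> dual_feasible B P c Y"

abbreviation "\<P> \<equiv> upper_image B b P C"

lemma finitely_generated_C: "finitely_generated_cone C"
  using finitely_generated_coneI[OF finite_columns, of Y] by (simp add: C_eq)

lemma finitely_generated_dual_C: "finitely_generated_cone (dual_cone C)"
  using finitely_generated_coneI[OF finite_columns, of Z] by (simp add: dual_C_eq)

lemmas closed_C = finitely_generated_cone_imp_closed[OF finitely_generated_C]
lemmas convex_cone_C = finitely_generated_cone_imp_convex_cone[OF finitely_generated_C]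

lemma transpose_Z_nonneg_iff: "transpose Z *v y \<ge> 0 \<longleftrightarrow> y \<in> C"
  using transpose_mult_nonneg_iff[of Z y] dual_cone_dual_cone[OF closed_C convex_cone_C]
  by (simp add: dual_C_eq)

lemma transpose_Y_nonneg_iff: "transpose Y *v w \<ge> 0 \<longleftrightarrow> w \<in> dual_cone C"
  using transpose_mult_nonneg_iff[of Y w] by (simp add: C_eq)

lemma dual_feasible_iff:
  "(u, w) \<in> \<T> \<longleftrightarrow>
     u \<ge> 0 \<and> (\<forall>x. u \<bullet> (B *v x) = w \<bullet> (P *v x)) \<and> c \<bullet> w = 1 \<and> w \<in> dual_cone C"
  by (simp add: dual_feasible_def transpose_Y_nonneg_iff transpose_mult_eq_iff)

text \<open>Division by \<open>z\<close> brings \<open>c + (1/z) *\<^sub>R v\<close> into a ball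
  around \<open>c\<close> inside \<open>C\<close> once \<open>z\<close> is at least
  \<open>norm v / e\<close>; the extra 1 keeps \<open>r\<close> positive when \<open>v\<close> is
  0.\<close>

lemma c_absorbs:
  obtains r where "r > 0" "\<And>z. z \<ge> r \<Longrightarrow> v + z *\<^sub>R c \<in> C"
proof -
  obtain e where e: "e > 0" "cball c e \<subseteq> C" using c_interior mem_interior_cball by blast
  define r where "r = norm v / e + 1"
  have r: "r > 0" using e by (simp add: r_def add_nonneg_pos)
  have "v + z *\<^sub>R c \<in> C" if z: "z \<ge> r" for z
  proof -
    have "z > 0" using r z by simp
    have "norm v / e \<le> z" using z by (simp add: r_def)
    then have "norm v \<le> e * z" using e by (simp add: field_simps)
    then have "c + (1/z) *\<^sub>R v \<in> cball c e"
      using \<open>z > 0\<close> by (simp add: dist_norm field_simps)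
    then have "z *\<^sub>R (c + (1/z) *\<^sub>R v) \<in> C"
      using e \<open>z > 0\<close> by (intro convex_cone_scaleR[OF convex_cone_C]) auto
    then show ?thesis using \<open>z > 0\<close> by (simp add: algebra_simps)
  qed
  then show ?thesis using that r by blast
qed

text \<open>Pairing \<open>w\<close> with the element \<open>- w + r *\<^sub>R c\<close> of
  \<open>C\<close> bounds \<open>r * (c \<bullet> w)\<close> below by the squared norm of
  \<open>w\<close>. Hence every nonzero \<open>w\<close> can be scaled to the normalization.\<close>

lemma c_inner_pos:
  assumes "w \<in> dual_cone C" "w \<noteq> 0"
  shows "c \<bullet> w > 0"
proof -
  obtain r where "r > 0" "- w + r *\<^sub>R c \<in> C" using c_absorbs[of "- w"] by blast
  then have "0 \<le> w \<bullet> (- w + r *\<^sub>R c)" using assms(1) unfolding dual_cone_def by blast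
  then have "0 < r * (c \<bullet> w)"
    using assms(2) by (simp add: inner_diff_right inner_commute) (smt (verit) inner_gt_zero_iff)
  then show ?thesis using \<open>r > 0\<close> by (simp add: zero_less_mult_iff)
qed

lemma mem_upper_image_iff: "y \<in> upper_image B \<beta> P C \<longleftrightarrow> (\<exists>x\<in>feasible B \<beta>. y - P *v x \<in> C)"
proof
  assume "\<exists>x\<in>feasible B \<beta>. y - P *v x \<in> C"
  then obtain x where "x \<in> feasible B \<beta>" "y - P *v x \<in> C" by blast
  then have "P *v x + (y - P *v x) \<in> upper_image B \<beta> P C"
    unfolding upper_image_def by (intro set_plus_intro imageI)
  then show "y \<in> upper_image B \<beta> P C" by simp
next
  assume "y \<in> upper_image B \<beta> P C"
  then obtain x k where "x \<in> feasible B \<beta>" "k \<in> C" "y = P *v x + k"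
    by (auto simp: upper_image_def elim!: set_plus_elim)
  then show "\<exists>x\<in>feasible B \<beta>. y - P *v x \<in> C" by (intro bexI[of _ x]) simp_all
qed

text \<open>\<open>\<beta>\<close> is kept general because the dual feasible set does not depend on
  the right-hand side: \<open>b\<close> gives the problem itself, 0 the homogeneous one.\<close>

lemma weak_duality:
  assumes "(u, w) \<in> \<T>" "y \<in> upper_image B \<beta> P C"
  shows "\<beta> \<bullet> u \<le> w \<bullet> y"
proof -
  obtain x where x: "B *v x \<ge> \<beta>" "y - P *v x \<in> C"
    using assms(2) by (auto simp: mem_upper_image_iff feasible_def)
  have "u \<bullet> (B *v x - \<beta>) \<ge> 0" using assms(1) x(1) by (intro inner_nonneg_vec) (auto simp: dual_feasible_iff)
  moreover have "w \<bullet> (y - P *v x) \<ge> 0" using assms(1) x(2) by (auto simp: dual_feasible_iff dual_cone_def)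
  moreover have "u \<bullet> (B *v x) = w \<bullet> (P *v x)" using assms(1) by (auto simp: dual_feasible_iff)
  ultimately show ?thesis by (simp add: inner_diff_right inner_commute)
qed

text \<open>Farkas' lemma, from the closedness of the cone of all pairs \<open>(B x - s, P x + k)\<close>.\<close>

lemma upper_image_eq:
  assumes "feasible B \<beta> \<noteq> {}"
  shows "upper_image B \<beta> P C = {y. \<forall>(u, w)\<in>\<T>. \<beta> \<bullet> u \<le> w \<bullet> y}"
proof
  define h where "h = (\<lambda>((x, s), k). (B *v x - s, P *v x + k))"
  define G where "G = h ` ((UNIV \<times> {s. s \<ge> 0}) \<times> C)"
  have "linear h"
    unfolding h_def
    by (intro linearI) (auto simp: matrix_vector_right_distrib matrix_vector_mult_scaleR algebra_simps)
  then have fg: "finitely_generated_cone G"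
    unfolding G_def
    by (intro finitely_generated_cone_linear_image finitely_generated_cone_Times
        finitely_generated_cone_UNIV finitely_generated_cone_orthant finitely_generated_C)
  show "{y. \<forall>(u, w)\<in>\<T>. \<beta> \<bullet> u \<le> w \<bullet> y} \<subseteq> upper_image B \<beta> P C"
  proof (rule subsetI, rule ccontr)
    fix y assume y: "y \<in> {y. \<forall>(u, w)\<in>\<T>. \<beta> \<bullet> u \<le> w \<bullet> y}" and n: "y \<notin> upper_image B \<beta> P C"
    have "(\<beta>, y) \<notin> G"
    proof
      assume "(\<beta>, y) \<in> G"
      then obtain x s k where "s \<ge> 0" "k \<in> C" "\<beta> = B *v x - s" "y = P *v x + k"
        by (auto simp: G_def h_def)
      then have "x \<in> feasible B \<beta>" "y - P *v x \<in> C" by (auto simp: feasible_def)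
      then show False using n mem_upper_image_iff by blast
    qed
    then obtain a where a: "a \<in> dual_cone G" "a \<bullet> (\<beta>, y) < 0"
      by (rule separating_closed_convex_cone[OF finitely_generated_cone_imp_closed[OF fg]
            finitely_generated_cone_imp_convex_cone[OF fg]])
    obtain u' w where "a = (u', w)" by (cases a)
    \<comment> \<open>\<open>G\<close> contains all pairs (-s, 0) with nonnegative s, so the first
      component of the separating functional is nonpositive.\<close>
    define u where "u = - u'"
    have ge: "- (u \<bullet> (B *v x - s)) + w \<bullet> (P *v x + k) \<ge> 0" if "s \<ge> 0" "k \<in> C" for x s k
    proof -
      have "h ((x, s), k) \<in> G" unfolding G_def using that by blast
      then have "a \<bullet> h ((x, s), k) \<ge> 0" using a(1) by (auto simp: dual_cone_def)
      then show ?thesis by (simp add: h_def \<open>a = (u', w)\<close> u_def)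
    qed
    have C0: "0 \<in> C" by (rule convex_cone_contains_0[OF convex_cone_C])
    have "u \<bullet> s \<ge> 0" if "s \<ge> 0" for s using ge[OF that C0, of 0] by simp
    then have u: "u \<ge> 0" unfolding nonneg_vec_iff_inner[of u] by blast
    have w: "w \<in> dual_cone C" using ge[OF order_refl, of _ 0] by (auto simp: dual_cone_def)
    have eq: "u \<bullet> (B *v x) = w \<bullet> (P *v x)" for x
      using ge[OF order_refl C0, of x] ge[OF order_refl C0, of "- x"]
      by (simp add: linear_neg[OF matrix_vector_mul_linear]) 
    have lt: "w \<bullet> y < \<beta> \<bullet> u"
      using a(2) by (simp add: \<open>a = (u', w)\<close> u_def inner_commute)
    show False
    proof (cases "w = 0")
      \<comment> \<open>Such a functional cannot be normalized; it would by itself certify that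
        \<open>B *v x \<ge> \<beta>\<close> has no solution.\<close>
      case True
      obtain x where "B *v x \<ge> \<beta>" using assms by (auto simp: feasible_def)
      then have "u \<bullet> (B *v x - \<beta>) \<ge> 0" using u by (intro inner_nonneg_vec) auto
      then show False using lt eq[of x] True by (simp add: inner_diff_right inner_commute)
    next
      case False
      define \<kappa> where "\<kappa> = 1 / (c \<bullet> w)"
      have \<kappa>: "\<kappa> > 0" using c_inner_pos[OF w False] by (simp add: \<kappa>_def)
      have "(\<kappa> *\<^sub>R u, \<kappa> *\<^sub>R w) \<in> \<T>"
        using \<kappa> u w eq c_inner_pos[OF w False]
        by (auto simp: dual_feasible_iff less_eq_vec_def dual_cone_def) (simp add: \<kappa>_def)
      then have "\<kappa> * (\<beta> \<bullet> u) \<le> \<kappa> * (w \<bullet> y)" using y by fastforce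
      then show False using \<kappa> lt by simp
    qed
  qed
qed (use weak_duality in auto)

lemmas primal_image_eq = upper_image_eq[OF feasible_nonempty]

lemma closed_upper_image: "closed \<P>"
proof -
  have "\<P> = (\<Inter>(u, w)\<in>\<T>. {y. w \<bullet> y \<ge> b \<bullet> u})" unfolding primal_image_eq by auto
  also have "closed \<dots>" by (auto intro!: closed_INT closed_halfspace_ge split: prod.splits)
  finally show ?thesis .
qed

lemma image_in_upper_image: "x \<in> feasible B \<beta> \<Longrightarrow> P *v x \<in> upper_image B \<beta> P C"
  using convex_cone_contains_0[OF convex_cone_C] unfolding mem_upper_image_iff
  by (intro bexI[of _ x]) simp_all

lemma upper_image_nonempty: "\<P> \<noteq> {}"
  using image_in_upper_image feasible_nonempty by blast

lemma upper_image_add_C: "y \<in> \<P> \<Longrightarrow> k \<in> C \<Longrightarrow> y + k \<in> \<P>"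
  using convex_cone_add[OF convex_cone_C] unfolding mem_upper_image_iff
  by (metis add.commute add_diff_eq)

section \<open>Existence of optimal solutions and strong duality\<close>

lemma optimal_D1_exists:
  assumes "(u0, w) \<in> \<T>"
  shows "\<exists>u. optimal_D1 B b P w u"
proof -
  obtain x where x: "B *v x \<ge> b" using feasible_nonempty by (auto simp: feasible_def)
  have bound: "b \<bullet> u \<le> w \<bullet> (P *v x)" if "u \<in> {u. u \<ge> 0}" "transpose B *v u = transpose P *v w" for u
  proof -
    have "u \<bullet> (B *v x - b) \<ge> 0" using that x by (intro inner_nonneg_vec) auto
    then show ?thesis using that by (simp add: transpose_mult_eq_iff inner_diff_right inner_commute)
  qed
  have "\<exists>u\<in>{u. u \<ge> 0}. transpose B *v u = transpose P *v w \<and>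
    (\<forall>u'\<in>{u. u \<ge> 0}. transpose B *v u' = transpose P *v w \<longrightarrow> b \<bullet> u' \<le> b \<bullet> u)"
    using assms bound
    by (intro conic_linear_program_attained[OF finitely_generated_cone_orthant, where ?x0.0 = u0])
      (auto simp: dual_feasible_def bounded_linear.linear[OF bounded_linear_inner_right])
  then show ?thesis by (auto simp: optimal_D1_def is_arg_max_linorder)
qed

definition P2_feasible where
  "P2_feasible t = (\<lambda>(x, z). x \<in> feasible B b \<and> t + z *\<^sub>R c - P *v x \<in> C)"

lemma optimal_P2_iff:
  "optimal_P2 B b P c Z t (x, z) \<longleftrightarrow>
     P2_feasible t (x, z) \<and> (\<forall>x' z'. P2_feasible t (x', z') \<longrightarrow> z \<le> z')"
proof -
  have "transpose Z *v (P *v x) \<le> transpose Z *v t + z *\<^sub>R (transpose Z *v c) \<longleftrightarrow>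
      transpose Z *v (t + z *\<^sub>R c - P *v x) \<ge> 0" for x z
    by (simp add: matrix_vector_right_distrib matrix_vector_mult_scaleR matrix_vector_mult_diff_distrib
        less_eq_vec_def)
  then show ?thesis
    unfolding optimal_P2_def P2_feasible_def transpose_Z_nonneg_iff
    by (auto simp: is_arg_min_linorder feasible_def)
qed

lemma optimal_D2_iff:
  "optimal_D2 B b P c Y t (u, w) \<longleftrightarrow>
     (u, w) \<in> \<T> \<and> (\<forall>(u', w')\<in>\<T>. b \<bullet> u' - t \<bullet> w' \<le> b \<bullet> u - t \<bullet> w)"
  unfolding optimal_D2_def dual_feasible_def by (auto simp: is_arg_max_linorder)

lemma P2_feasible_upper_image: "t + z *\<^sub>R c \<in> \<P> \<longleftrightarrow> (\<exists>x. P2_feasible t (x, z))"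
  by (auto simp: P2_feasible_def mem_upper_image_iff)

lemma P2_D2_weak_duality:
  assumes "(u, w) \<in> \<T>" "t + z *\<^sub>R c \<in> \<P>"
  shows "b \<bullet> u - t \<bullet> w \<le> z"
  using weak_duality[OF assms] assms(1)
  by (simp add: dual_feasible_iff inner_add_right inner_commute)

lemma ex_shift_upper_image: "\<exists>z. t + z *\<^sub>R c \<in> \<P>"
proof -
  obtain y where y: "y \<in> \<P>" using upper_image_nonempty by blast
  obtain r where "t - y + r *\<^sub>R c \<in> C" using c_absorbs[of "t - y"] by blast
  from upper_image_add_C[OF y this] show ?thesis by (auto simp: algebra_simps)
qed

text \<open>The optimal value is the least \<open>z\<close> for which t + z c lies in the closed
  upper image; any dual feasible pair bounds it below.\<close>

lemma optimal_P2_exists: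
  assumes "\<T> \<noteq> {}"
  shows "\<exists>x z. optimal_P2 B b P c Z t (x, z)"
proof -
  define V where "V = {z. t + z *\<^sub>R c \<in> \<P>}"
  obtain u w where uw: "(u, w) \<in> \<T>" using assms by auto
  have "V = (\<lambda>z. t + z *\<^sub>R c) -` \<P>" by (auto simp: V_def)
  then have "closed V"
    by (auto intro!: continuous_closed_vimage closed_upper_image continuous_intros)
  moreover have "V \<noteq> {}" using ex_shift_upper_image by (auto simp: V_def)
  moreover have "bdd_below V" using P2_D2_weak_duality[OF uw] by (auto simp: V_def intro!: bdd_belowI)
  ultimately have "Inf V \<in> V" by (intro closed_contains_Inf)
  then obtain x where "P2_feasible t (x, Inf V)" by (auto simp: V_def P2_feasible_upper_image)
  moreover have "Inf V \<le> z" if "P2_feasible t (x', z)" for x' z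
    using that \<open>bdd_below V\<close> P2_feasible_upper_image by (intro cInf_lower) (auto simp: V_def)
  ultimately show ?thesis unfolding optimal_P2_iff by blast
qed

lemma optimal_D2_exists:
  assumes "\<T> \<noteq> {}"
  shows "\<exists>u w. optimal_D2 B b P c Y t (u, w)"
proof -
  obtain u0 w0 where uw: "(u0, w0) \<in> \<T>" using assms by auto
  obtain z where z: "t + z *\<^sub>R c \<in> \<P>" using ex_shift_upper_image by blast
  define f where "f = (\<lambda>(u, w). (transpose B *v u - transpose P *v w, c \<bullet> w))"
  define g where "g = (\<lambda>(u, w). b \<bullet> u - t \<bullet> w)"
  define K where "K = {u::real^'m. u \<ge> 0} \<times> dual_cone C"
  have feas: "p \<in> \<T> \<longleftrightarrow> p \<in> K \<and> f p = (0, 1)" for p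
    by (cases p) (auto simp: dual_feasible_def K_def f_def transpose_Y_nonneg_iff)
  have "linear f" unfolding f_def
    by (intro linearI) (auto simp: matrix_vector_right_distrib matrix_vector_mult_scaleR algebra_simps)
  moreover have "linear g" unfolding g_def
    by (intro linearI) (auto simp: algebra_simps)
  moreover have "finitely_generated_cone K"
    unfolding K_def
    by (intro finitely_generated_cone_Times finitely_generated_cone_orthant finitely_generated_dual_C)
  ultimately have "\<exists>p\<in>K. f p = (0, 1) \<and> (\<forall>p'\<in>K. f p' = (0, 1) \<longrightarrow> g p' \<le> g p)"
    using uw P2_D2_weak_duality[OF _ z] feas
    by (intro conic_linear_program_attained[where M = z and ?x0.0 = "(u0, w0)"]) (auto simp: g_def)
  then obtain p where "p \<in> \<T>" "\<forall>p'\<in>\<T>. g p' \<le> g p" using feas by metis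
  then have "optimal_D2 B b P c Y t (fst p, snd p)"
    unfolding optimal_D2_iff g_def by (auto split: prod.splits)
  then show ?thesis by blast
qed

text \<open>By the normalization, t + v c satisfies all inequalities of
  \<open>primal_image_eq\<close> exactly when v is at least every dual value. The dual optimum is
  therefore attained as a feasible \<open>z\<close> of (P_2(t)).\<close>

lemma P2_D2_strong_duality:
  assumes P2: "optimal_P2 B b P c Z t (x, z)" and D2: "optimal_D2 B b P c Y t (u, w)"
  shows "z = b \<bullet> u - t \<bullet> w"
proof (rule antisym)
  have "t + z *\<^sub>R c \<in> \<P>" using P2 by (auto simp: optimal_P2_iff P2_feasible_upper_image)
  then show "b \<bullet> u - t \<bullet> w \<le> z" using D2 by (auto simp: optimal_D2_iff intro: P2_D2_weak_duality)
  have "t + (b \<bullet> u - t \<bullet> w) *\<^sub>R c \<in> \<P>"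
    unfolding primal_image_eq
  proof clarify
    fix u' w' assume uw': "(u', w') \<in> \<T>"
    then have "b \<bullet> u' - t \<bullet> w' \<le> b \<bullet> u - t \<bullet> w" using D2 by (auto simp: optimal_D2_iff)
    then show "b \<bullet> u' \<le> w' \<bullet> (t + (b \<bullet> u - t \<bullet> w) *\<^sub>R c)"
      using uw' by (simp add: dual_feasible_iff inner_add_right inner_commute)
  qed
  then show "z \<le> b \<bullet> u - t \<bullet> w" using P2 by (auto simp: optimal_P2_iff P2_feasible_upper_image)
qed

end

section \<open>Outer approximations and the algorithm\<close>

locale vlp_algorithm = vector_linear_program B b P C c Y Z
  for B :: "real ^ 'n ^ 'm"
    and b :: "real ^ 'm"
    and P :: "real ^ 'n ^ 'q::{finite,linorder}"
    and C :: "(real ^ 'q::{finite,linorder}) set"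
    and c :: "real ^ 'q::{finite,linorder}"
    and Y :: "real ^ 'k ^ 'q::{finite,linorder}"
    and Z :: "real ^ 'l ^ 'q::{finite,linorder}" +
  fixes Sbarh :: "(real ^ 'n) set"
    and Tbarh :: "((real ^ 'm) \<times> (real ^ 'q::{finite,linorder})) set"
    and brk :: bool
  assumes extreme_point: "\<exists>v. v extreme_point_of (upper_image B 0 P C)"
    and primal_solution_h: "primal_solution B 0 P C {0} Sbarh"
    and dual_solution_h: "dual_solution B 0 P c Y Tbarh"
begin

abbreviation "\<P>h \<equiv> upper_image B 0 P C"

lemma Tbarh: "finite Tbarh" "Tbarh \<noteq> {}" "Tbarh \<subseteq> \<T>"
  using dual_solution_h by (auto simp: dual_solution_def finite_supremizer_def)

lemma dual_feasible_nonempty: "\<T> \<noteq> {}"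
  using Tbarh by auto

lemma homogeneous_image_eq: "\<P>h = {y. \<forall>(u, w)\<in>\<T>. 0 \<le> w \<bullet> y}"
proof -
  have "0 \<in> feasible B 0" by (simp add: feasible_def)
  then show ?thesis using upper_image_eq[of 0] by auto
qed

text \<open>The dual solution generates the homogeneous lower image, and the coupling of
  \<open>d\<close> with \<open>dual_obj 0 (u, w)\<close> is \<open>w \<bullet> d\<close>. So the
  finitely many normals in \<open>Tbarh\<close> already cut out the homogeneous upper image.\<close>

lemma homogeneous_imageI:
  assumes "\<And>u w. (u, w) \<in> Tbarh \<Longrightarrow> 0 \<le> w \<bullet> d"
  shows "d \<in> \<P>h"
  unfolding homogeneous_image_eq
proof clarify
  fix u w assume uw: "(u, w) \<in> \<T>"
  have "coupling c d x \<ge> 0" if x: "x \<in> dual_obj 0 ` Tbarh" for x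
  proof -
    obtain u' w' where "(u', w') \<in> Tbarh" "x = dual_obj 0 (u', w')" using x by auto
    moreover have "c \<bullet> w' = 1" using \<open>(u', w') \<in> Tbarh\<close> Tbarh by (auto simp: dual_feasible_iff)
    ultimately show ?thesis using assms by (simp add: coupling_dual_obj[OF c_last])
  qed
  moreover have "dual_obj 0 (u, w) \<in> convex hull (dual_obj 0 ` Tbarh) + convex_cone hull {- e_last}"
  proof -
    have "dual_obj 0 (u, w) + 0 \<in> dual_obj 0 ` \<T> + uminus ` K_cone"
      using uw by (intro set_plus_intro imageI) (auto simp: K_cone_uminus convex_cone_hull_contains_0)
    then show ?thesis
      using dual_solution_h unfolding dual_solution_def finite_supremizer_def by (simp add: K_cone_uminus)
  qed
  ultimately have "coupling c d (dual_obj 0 (u, w)) \<ge> 0" by (rule coupling_nonneg_superset)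
  moreover have "c \<bullet> w = 1" using uw by (simp add: dual_feasible_iff)
  ultimately show "0 \<le> w \<bullet> d" by (simp add: coupling_dual_obj[OF c_last])
qed

lemma upper_image_add_homogeneous: "y \<in> \<P> \<Longrightarrow> d \<in> \<P>h \<Longrightarrow> y + d \<in> \<P>"
  unfolding primal_image_eq homogeneous_image_eq by (fastforce simp: inner_add_right)

section \<open>Outer approximations and the calls of dual\<close>

definition outer ::
    "((real ^ 'm) \<times> (real ^ 'q::{finite,linorder})) set \<Rightarrow> (real ^ 'q::{finite,linorder}) set" where
  "outer T = {y. \<forall>(u, w)\<in>T. b \<bullet> u \<le> w \<bullet> y}"

text \<open>The last conjunct keeps every normal of the homogeneous solution, which controls the
  recession directions of \<open>outer T\<close>. It compares second components only, since step 0
  replaces \<open>u\<close> by an optimal solution of (D_1(w)).\<close>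

definition "admissible T \<longleftrightarrow> finite T \<and> T \<subseteq> \<T> \<and> (\<forall>p\<in>T. maximizer B b P c Y p) \<and> snd ` Tbarh \<subseteq> snd ` T"

lemma admissible_nonempty: "admissible T \<Longrightarrow> T \<noteq> {}"
  using Tbarh unfolding admissible_def by auto

lemma upper_image_subset_outer: "T \<subseteq> \<T> \<Longrightarrow> \<P> \<subseteq> outer T"
  unfolding outer_def primal_image_eq by auto

lemma recession_outer:
  assumes "admissible T" and ray: "\<And>s. s \<ge> 0 \<Longrightarrow> y + s *\<^sub>R d \<in> outer T"
  shows "d \<in> \<P>h"
proof (rule homogeneous_imageI)
  fix u w assume "(u, w) \<in> Tbarh"
  then have "w \<in> snd ` Tbarh" by force
  then obtain u' where T: "(u', w) \<in> T" using assms(1) by (force simp: admissible_def)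
  show "0 \<le> w \<bullet> d"
  proof (rule ccontr)
    assume n: "\<not> ?thesis"
    then obtain s where s: "w \<bullet> y - b \<bullet> u' < real s * (- (w \<bullet> d))"
      using reals_Archimedean3[of "- (w \<bullet> d)"] by auto
    have "b \<bullet> u' \<le> w \<bullet> (y + real s *\<^sub>R d)" using ray[of "real s"] T by (auto simp: outer_def)
    then show False using s by (simp add: inner_add_right)
  qed
qed

lemma pointed_outer:
  assumes "admissible T"
  shows "pointed (outer T)"
  unfolding pointed_def
proof clarify
  fix y d assume d: "d \<noteq> 0" and line: "\<forall>t. y + t *\<^sub>R d \<in> outer T"
  have "d \<in> \<P>h" using line by (intro recession_outer[OF assms, of y]) auto
  moreover have "- d \<in> \<P>h"
  proof (intro recession_outer[OF assms, of y])
    fix s :: real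
    show "y + s *\<^sub>R (- d) \<in> outer T" using line[rule_format, of "- s"] by simp
  qed
  moreover obtain v where v: "v extreme_point_of \<P>h" using extreme_point by blast
  moreover have "v \<in> \<P>h" using v by (simp add: extreme_point_of_def)
  ultimately have "v + d \<in> \<P>h" "v - d \<in> \<P>h"
    unfolding homogeneous_image_eq by (fastforce simp: inner_add_right inner_diff_right)+
  moreover have "v \<in> open_segment (v + d) (v - d)"
  proof -
    have "v = midpoint (v + d) (v - d)" by (simp add: midpoint_def vec_eq_iff)
    moreover have "v + d \<noteq> v - d" using d by (simp add: vec_eq_iff)
    ultimately show ?thesis by (metis midpoint_in_open_segment)
  qed
  ultimately show False using v by (auto simp: extreme_point_of_def)
qed

lemma polyhedron_outer: "finite T \<Longrightarrow> polyhedron (outer T)"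
proof -
  assume "finite T"
  have "outer T = \<Inter> ((\<lambda>(u, w). {y. w \<bullet> y \<ge> b \<bullet> u}) ` T)" by (auto simp: outer_def)
  also have "polyhedron \<dots>"
    using \<open>finite T\<close> by (intro polyhedron_Inter) (auto intro: polyhedron_halfspace_ge)
  finally show ?thesis .
qed

lemma coupling_outer:
  assumes "T \<subseteq> \<T>"
  shows "{y. \<forall>y'\<in>convex hull (dual_obj b ` T) + convex_cone hull {- e_last}. coupling c y y' \<ge> 0} = outer T"
proof (intro equalityI subsetI)
  have eq: "coupling c y (dual_obj b (u, w)) = w \<bullet> y - b \<bullet> u" if "(u, w) \<in> T" for y u w
    using that assms by (intro coupling_dual_obj[OF c_last]) (auto simp: dual_feasible_iff)
  {
    fix y assume y: "y \<in> {y. \<forall>y'\<in>convex hull (dual_obj b ` T) + convex_cone hull {- e_last}. coupling c y y' \<ge> 0}"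
    show "y \<in> outer T"
      unfolding outer_def
    proof clarify
      fix u w assume uw: "(u, w) \<in> T"
      have "dual_obj b (u, w) + 0 \<in> convex hull (dual_obj b ` T) + convex_cone hull {- e_last}"
        using uw by (intro set_plus_intro hull_inc imageI convex_cone_hull_contains_0)
      then show "b \<bullet> u \<le> w \<bullet> y" using y eq[OF uw, of y] by auto
    qed
  next
    fix y assume "y \<in> outer T"
    then have "coupling c y x \<ge> 0" if "x \<in> dual_obj b ` T" for x
      using that eq by (fastforce simp: outer_def)
    then show "y \<in> {y. \<forall>y'\<in>convex hull (dual_obj b ` T) + convex_cone hull {- e_last}. coupling c y y' \<ge> 0}"
      using coupling_nonneg_superset by blast
  }
qed

lemma dual_returns_D:
  assumes "T \<subseteq> \<T>" "dual_returns c (dual_obj b ` T) {- e_last} Tp Td"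
  shows "minimal_V_representation (outer T) Tp Td"
    and "convex hull (dual_obj b ` T) + convex_cone hull {- e_last} = {y'. \<forall>y\<in>outer T. coupling c y y' \<ge> 0}"
  using assms(2) unfolding dual_returns_def V_representation_def
  by (auto simp: coupling_outer[OF assms(1)])

text \<open>Besides a minimal representation of the approximation, the call needs that the downward
  closed set spanned by the dual objective values is its own bidual. The point \<open>y0\<close> for
  this is taken from the nonempty upper image.\<close>

lemma dual_returns_exists:
  assumes "admissible T"
  shows "\<exists>Tp Td. dual_returns c (dual_obj b ` T) {- e_last} Tp Td"
proof -
  have T: "finite T" "T \<subseteq> \<T>" "T \<noteq> {}"
    using assms admissible_nonempty by (auto simp: admissible_def)
  define A where "A = convex hull (dual_obj b ` T) + convex_cone hull {- e_last}"
  obtain Tp Td where m: "minimal_V_representation (outer T) Tp Td"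
    using pointed_polyhedron_minimal_V_representation[OF polyhedron_outer[OF T(1)] pointed_outer[OF assms]]
    by blast
  have outer: "{y. \<forall>y'\<in>A. coupling c y y' \<ge> 0} = outer T"
    unfolding A_def by (rule coupling_outer[OF T(2)])
  have "e_last \<noteq> (0 :: real^'q::{finite,linorder})" using e_last_nth[of last_index] by (metis zero_index zero_neq_one)
  then have V: "V_representation A (dual_obj b ` T) {- e_last}"
    using T(1) by (simp add: V_representation_def A_def)
  obtain y0 where y0: "y0 \<in> outer T"
    using upper_image_nonempty upper_image_subset_outer[OF T(2)] by blast
  have bidual: "z \<in> A" if "\<forall>y\<in>outer T. coupling c y z \<ge> 0" for z
  proof (rule coupling_bidual[OF c_last, of _ y0])
    show "closed A" "convex A" unfolding A_def using T(1)
      by (auto intro: closed_convex_hull_plus_cone convex_convex_hull_plus_cone)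
    obtain p where "p \<in> T" using T(3) by blast
    then have "dual_obj b p + 0 \<in> A"
      unfolding A_def by (intro set_plus_intro hull_inc imageI convex_cone_hull_contains_0)
    then show "A \<noteq> {}" by blast
    show "x - e_last \<in> A" if x: "x \<in> A" for x
    proof -
      obtain p k where "x = p + k" "p \<in> convex hull (dual_obj b ` T)" "k \<in> convex_cone hull {- e_last}"
        using x unfolding A_def by (auto elim: set_plus_elim)
      moreover have "k + - e_last \<in> convex_cone hull {- e_last}"
        using calculation(3) by (rule convex_cone_hull_add) (simp add: hull_inc)
      ultimately have "p + (k + - e_last) \<in> A" unfolding A_def by blast
      then show ?thesis using \<open>x = p + k\<close> by (simp add: algebra_simps)
    qed
    show "\<forall>x\<in>A. coupling c y0 x \<ge> 0" using y0 outer by blast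
    show "\<forall>y. (\<forall>x\<in>A. coupling c y x \<ge> 0) \<longrightarrow> coupling c y z \<ge> 0" using that outer by blast
  qed
  have A_eq: "A = {y'. \<forall>y\<in>outer T. coupling c y y' \<ge> 0}" using bidual outer by blast
  have "dual_returns c (dual_obj b ` T) {- e_last} Tp Td"
    unfolding dual_returns_def
    by (intro exI[of _ "outer T"] exI[of _ A] conjI V A_eq m outer[symmetric])
  then show ?thesis by blast
qed

lemma normalized_vec_eqI:
  assumes "c \<bullet> w = 1" "c \<bullet> w' = 1" "\<And>i. i \<noteq> last_index \<Longrightarrow> w' $ i = w $ i"
  shows "w' = w"
proof -
  have "(\<Sum>i\<in>UNIV - {last_index}. c $ i * w' $ i) = (\<Sum>i\<in>UNIV - {last_index}. c $ i * w $ i)"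
    using assms(3) by (intro sum.cong) auto
  moreover have "c \<bullet> v = v $ last_index + (\<Sum>i\<in>UNIV - {last_index}. c $ i * v $ i)" for v
    unfolding inner_vec_def using c_last by (subst sum.remove[of _ last_index]) auto
  ultimately have "w' $ last_index = w $ last_index" using assms(1,2) by (metis add_right_cancel)
  then show ?thesis using assms(3) by (metis vec_eq_iff)
qed

text \<open>A better image differs only along \<open>e_last\<close>, so \<open>w'\<close> agrees
  with \<open>w\<close> in all coordinates but the last. The normalization then forces
  \<open>w' = w\<close>, and only \<open>b \<bullet> u\<close> is left to compare.\<close>

lemma maximizerI:
  assumes "(u, w) \<in> \<T>" and best: "\<And>u'. (u', w) \<in> \<T> \<Longrightarrow> b \<bullet> u' \<le> b \<bullet> u"
  shows "maximizer B b P c Y (u, w)"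
  unfolding maximizer_def
proof (intro conjI notI)
  assume "\<exists>p'\<in>\<T>. cone_le K_cone (dual_obj b (u, w)) (dual_obj b p') \<and> dual_obj b p' \<noteq> dual_obj b (u, w)"
  then obtain u' w' s where p': "(u', w') \<in> \<T>" "s \<ge> 0"
    and eq: "dual_obj b (u', w') - dual_obj b (u, w) = s *\<^sub>R e_last"
    and ne: "dual_obj b (u', w') \<noteq> dual_obj b (u, w)"
    by (auto simp: cone_le_def K_cone_def)
  have nth: "dual_obj b (u', w') $ i - dual_obj b (u, w) $ i = s * e_last $ i" for i
    using arg_cong[OF eq, of "\<lambda>v. v $ i"] by simp
  have "w' $ i = w $ i" if "i \<noteq> last_index" for i
    using nth[of i] that by (simp add: dual_obj_def e_last_nth)
  then have "w' = w"
    using p'(1) assms(1) by (intro normalized_vec_eqI) (auto simp: dual_feasible_iff)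
  then have "b \<bullet> u' \<le> b \<bullet> u" using best p'(1) by blast
  moreover have "b \<bullet> u' - b \<bullet> u = s" using nth[of last_index] by (simp add: dual_obj_def e_last_nth)
  ultimately have "s = 0" using p'(2) by simp
  then show False using eq ne by simp
qed (rule assms(1))

lemma optimal_D1_maximizer:
  assumes "(u0, w) \<in> \<T>" "optimal_D1 B b P w u"
  shows "maximizer B b P c Y (u, w)"
  using assms by (intro maximizerI) (auto simp: dual_feasible_def optimal_D1_def is_arg_max_linorder)

lemma optimal_D2_maximizer:
  assumes "optimal_D2 B b P c Y t (u, w)"
  shows "maximizer B b P c Y (u, w)"
  using assms unfolding optimal_D2_iff by (intro maximizerI) fastforce+

text \<open>
  Pairs of index sets stand for the faces of the polyhedron of all \<open>(x, y)\<close> with \<open>B x \<ge> b\<close> and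
  \<open>y - P x \<in> C\<close>: the inequalities that are tight at a point. Such a pair is covered when some
  \<open>(u, w)\<close> supports the upper image along the whole face. An optimal solution of the
  linear program for a vertex outside the upper image covers a face that was not covered before.
\<close>

definition "slacks x y = (B *v x - b, transpose Z *v (y - P *v x))"

definition "active x y = ({i. fst (slacks x y) $ i = 0}, {j. snd (slacks x y) $ j = 0})"

definition "covered T = {A. \<exists>(u, w)\<in>T. \<forall>x\<in>feasible B b. \<forall>y.
   y - P *v x \<in> C \<longrightarrow> active x y = A \<longrightarrow> w \<bullet> y = b \<bullet> u}"

definition "uncovered T = card (- covered T)"

lemma covered_mono: "T \<subseteq> T' \<Longrightarrow> covered T \<subseteq> covered T'"
  unfolding covered_def by blast

lemma uncovered_mono: "T \<subseteq> T' \<Longrightarrow> uncovered T' \<le> uncovered T"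
  unfolding uncovered_def using covered_mono by (intro card_mono) auto

text \<open>With \<open>w = Z *v v\<close>, the gap \<open>w \<bullet> y - b \<bullet> u\<close> is
  the sum of two nonnegative products of multipliers with slacks. It vanishes when positive
  multipliers meet only zero slacks, which depends on the active set alone.\<close>

lemma complementary_slackness:
  assumes uw: "(u, w) \<in> \<T>"
    and x: "x \<in> feasible B b" "y - P *v x \<in> C" "w \<bullet> y = b \<bullet> u"
    and x': "x' \<in> feasible B b" "y' - P *v x' \<in> C" "active x' y' = active x y"
  shows "w \<bullet> y' = b \<bullet> u"
proof -
  have u: "u \<ge> 0" and w: "w \<in> dual_cone C" and eq: "\<And>x. u \<bullet> (B *v x) = w \<bullet> (P *v x)"
    using uw by (auto simp: dual_feasible_iff)
  obtain v where v: "v \<ge> 0" "w = Z *v v"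
    using convex_cone_hull_columnsE[of w Z] w by (auto simp: dual_C_eq)
  have wv: "w \<bullet> k = v \<bullet> (transpose Z *v k)" for k
    by (metis inner_commute inner_transpose_mult v(2))
  have s: "B *v x - b \<ge> 0" "transpose Z *v (y - P *v x) \<ge> 0"
    using x by (auto simp: feasible_def transpose_Z_nonneg_iff)
  have ge: "u \<bullet> (B *v x - b) \<ge> 0" "v \<bullet> (transpose Z *v (y - P *v x)) \<ge> 0"
    using s u v by (auto intro: inner_nonneg_vec)
  have sum: "u \<bullet> (B *v x - b) + v \<bullet> (transpose Z *v (y - P *v x)) = w \<bullet> y - b \<bullet> u" for x y
    by (simp add: wv[symmetric] inner_diff_right eq inner_commute)
  have "u \<bullet> (B *v x - b) = 0" "v \<bullet> (transpose Z *v (y - P *v x)) = 0"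
    using sum[of x y] x(3) ge by linarith+
  moreover have "(B *v x' - b) $ i = 0" if "(B *v x - b) $ i = 0" for i
    using x'(3) that unfolding active_def slacks_def fst_conv prod.inject by blast
  moreover have "(transpose Z *v (y' - P *v x')) $ j = 0" if "(transpose Z *v (y - P *v x)) $ j = 0" for j
    using x'(3) that unfolding active_def slacks_def snd_conv prod.inject by blast
  ultimately have "u \<bullet> (B *v x' - b) = 0" "v \<bullet> (transpose Z *v (y' - P *v x')) = 0"
    using inner_zero_transfer[OF u s(1)] inner_zero_transfer[OF v(1) s(2)] by blast+
  then show ?thesis using sum[of x' y'] by simp
qed

text \<open>Strong duality makes the new pair tight at \<open>y\<close>, hence on the whole face. An
  old pair tight there would contradict \<open>t \<in> outer T\<close>, which is at hand as long as
  the pass has not yet changed \<open>T\<close>.\<close>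

lemma cut_uncovered:
  assumes T: "T \<subseteq> \<T>" and t: "t \<in> outer T"
    and P2: "optimal_P2 B b P c Z t (x, z)" and D2: "optimal_D2 B b P c Y t (u, w)" and "z > 0"
  shows "uncovered (insert (u, w) T) < uncovered T"
proof -
  define y where "y = t + z *\<^sub>R c"
  have x: "x \<in> feasible B b" "y - P *v x \<in> C"
    using P2 by (auto simp: optimal_P2_iff P2_feasible_def y_def)
  have uw: "(u, w) \<in> \<T>" using D2 by (simp add: optimal_D2_iff)
  then have "w \<bullet> y = b \<bullet> u"
    using P2_D2_strong_duality[OF P2 D2] by (simp add: y_def inner_add_right dual_feasible_iff inner_commute)
  then have "active x y \<in> covered (insert (u, w) T)"
    unfolding covered_def using complementary_slackness[OF uw x] by blast
  moreover have "active x y \<notin> covered T"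
  proof
    assume "active x y \<in> covered T"
    then obtain u' w' where uw': "(u', w') \<in> T" "w' \<bullet> y = b \<bullet> u'" unfolding covered_def using x by blast
    have "b \<bullet> u' \<le> w' \<bullet> t" using t uw'(1) by (auto simp: outer_def)
    moreover have "c \<bullet> w' = 1" using uw'(1) T by (auto simp: dual_feasible_iff)
    ultimately show False using uw'(2) \<open>z > 0\<close> by (simp add: y_def inner_add_right inner_commute)
  qed
  moreover have "covered T \<subseteq> covered (insert (u, w) T)" by (rule covered_mono) auto
  ultimately have "- covered (insert (u, w) T) \<subset> - covered T" by blast
  then show ?thesis unfolding uncovered_def by (intro psubset_card_mono) auto
qed

text \<open>If \<open>t\<close> dominated another image point p, it would be the midpoint of p and p
  + 2 (t - p), which both lie in the upper image and so in \<open>outer T\<close>. Hence only points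
  mapped onto \<open>t\<close> lie below it.\<close>

lemma no_cut_vertex:
  assumes T: "T \<subseteq> \<T>" and t: "t extreme_point_of outer T"
    and P2: "optimal_P2 B b P c Z t (x, z)" and "z \<le> 0"
  shows "P *v x = t" "minimizer B b P C x"
proof -
  have attained: "P *v x' = t" if x': "x' \<in> feasible B b" "t - P *v x' \<in> C" for x'
  proof (rule ccontr)
    assume ne: "P *v x' \<noteq> t"
    define k where "k = t - P *v x'"
    have "P *v x' \<in> \<P>" by (rule image_in_upper_image[OF x'(1)])
    moreover have "P *v x' + 2 *\<^sub>R k \<in> \<P>"
      using x'(2) by (intro upper_image_add_C calculation convex_cone_scaleR[OF convex_cone_C]) (auto simp: k_def)
    moreover have "t \<in> open_segment (P *v x') (P *v x' + 2 *\<^sub>R k)"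
    proof -
      have "t = midpoint (P *v x') (P *v x' + 2 *\<^sub>R k)"
        by (simp add: midpoint_def k_def vec_eq_iff field_simps)
      moreover have "P *v x' \<noteq> P *v x' + 2 *\<^sub>R k" using ne by (simp add: k_def)
      ultimately show ?thesis by (metis midpoint_in_open_segment)
    qed
    ultimately show False
      using t upper_image_subset_outer[OF T] by (auto simp: extreme_point_of_def)
  qed
  have x: "x \<in> feasible B b" "t + z *\<^sub>R c - P *v x \<in> C"
    using P2 by (auto simp: optimal_P2_iff P2_feasible_def)
  have "c \<in> C" using c_interior interior_subset by blast
  then have "(t + z *\<^sub>R c - P *v x) + (- z) *\<^sub>R c \<in> C"
    using \<open>z \<le> 0\<close> by (intro convex_cone_add[OF convex_cone_C] x convex_cone_scaleR[OF convex_cone_C]) auto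
  then have "t - P *v x \<in> C" by (simp add: algebra_simps)
  then show eq: "P *v x = t" by (rule attained[OF x(1)])
  show "minimizer B b P C x"
    unfolding minimizer_def cone_le_def eq using x(1) attained by blast
qed

text \<open>After a pass without cuts all vertices of the approximation are images of feasible
  points, and the other generators lie in the homogeneous image by \<open>recession_outer\<close>;
  their sums stay in the upper image.\<close>

lemma finished_outer_eq:
  assumes T: "admissible T" and ret: "dual_returns c (dual_obj b ` T) {- e_last} ((*v) P ` S) Td"
    and S: "\<forall>x\<in>S. minimizer B b P C x"
  shows "convex hull ((*v) P ` S) \<subseteq> \<P>" "convex_cone hull Td \<subseteq> \<P>h" "outer T = \<P>" "S \<noteq> {}"
proof -
  have T': "T \<subseteq> \<T>" using T by (simp add: admissible_def)
  have eq: "outer T = convex hull ((*v) P ` S) + convex_cone hull Td"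
    using dual_returns_D(1)[OF T' ret] by (simp add: minimal_V_representation_def V_representation_def)
  have sub: "\<P> \<subseteq> outer T" by (rule upper_image_subset_outer[OF T'])
  show "S \<noteq> {}" using sub upper_image_nonempty eq by auto
  then obtain y where y: "y \<in> (*v) P ` S" by blast
  show S_sub: "convex hull ((*v) P ` S) \<subseteq> \<P>"
  proof (rule hull_minimal)
    show "(*v) P ` S \<subseteq> \<P>" using S image_in_upper_image by (auto simp: minimizer_def)
    have "\<P> = (\<Inter>(u, w)\<in>\<T>. {y. w \<bullet> y \<ge> b \<bullet> u})" unfolding primal_image_eq by auto
    then show "convex \<P>" by (auto intro!: convex_INT convex_halfspace_ge split: prod.splits)
  qed
  show Td: "convex_cone hull Td \<subseteq> \<P>h"
  proof
    fix d assume "d \<in> convex_cone hull Td"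
    then have "y + s *\<^sub>R d \<in> outer T" if "s \<ge> 0" for s
      unfolding eq using that by (intro set_plus_intro hull_inc[OF y] convex_cone_hull_mul)
    then show "d \<in> \<P>h" by (rule recession_outer[OF T])
  qed
  have "outer T \<subseteq> \<P>"
    unfolding eq using S_sub Td upper_image_add_homogeneous by (auto elim!: set_plus_elim)
  then show "outer T = \<P>" using sub by blast
qed

text \<open>The directions \<open>Td\<close> need not be images of feasible directions. They are
  exchanged for \<open>Sbarh\<close> by enlarging their cone to the homogeneous upper image, which
  the images of \<open>Sbarh\<close> generate together with \<open>C\<close>.\<close>

lemma finished_primal_solution:
  assumes T: "admissible T" and ret: "dual_returns c (dual_obj b ` T) {- e_last} ((*v) P ` S) Td"
    and S: "\<forall>x\<in>S. minimizer B b P C x" "finite S"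
  shows "primal_solution B b P C S Sbarh"
proof -
  have T': "T \<subseteq> \<T>" using T by (simp add: admissible_def)
  note fin = finished_outer_eq[OF T ret S(1)]
  have eq: "\<P> = convex hull ((*v) P ` S) + convex_cone hull Td"
    using dual_returns_D(1)[OF T' ret] fin(3) by (simp add: minimal_V_representation_def V_representation_def)
  have "convex_cone hull ((*v) P ` Sbarh) + C = \<P>h"
    using primal_solution_h unfolding primal_solution_def finite_infimizer_def upper_image_def
    by (simp add: add.assoc)
  moreover have "convex hull ((*v) P ` S) + \<P>h = \<P>"
  proof
    show "convex hull ((*v) P ` S) + \<P>h \<subseteq> \<P>"
      using fin(1) upper_image_add_homogeneous by (auto elim!: set_plus_elim)
    show "\<P> \<subseteq> convex hull ((*v) P ` S) + \<P>h"
      unfolding eq by (rule set_plus_mono2[OF order_refl fin(2)])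
  qed
  ultimately have "convex hull ((*v) P ` S) + convex_cone hull ((*v) P ` Sbarh) + C = \<P>"
    by (simp add: add.assoc)
  then show ?thesis
    using S fin(4) primal_solution_h
    by (auto simp: primal_solution_def finite_infimizer_def upper_image_def minimizer_def)
qed

text \<open>The harder inclusion uses the biduality demanded of dual: the left-hand side consists of
  all points coupled nonnegatively with the approximation, which now equals the upper image.\<close>

lemma finished_lower_image:
  assumes T: "admissible T" and ret: "dual_returns c (dual_obj b ` T) {- e_last} ((*v) P ` S) Td"
    and S: "\<forall>x\<in>S. minimizer B b P C x"
  shows "convex hull (dual_obj b ` T) + convex_cone hull {- e_last} = lower_image B b P c Y"
proof
  have T': "T \<subseteq> \<T>" using T by (simp add: admissible_def)
  have "convex \<T>"
  proof -
    define f where "f p = (transpose B *v fst p - transpose P *v snd p, c \<bullet> snd p)"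
      for p :: "(real^'m) \<times> (real^'q::{finite,linorder})"
    have "linear f"
      unfolding f_def
      by (intro linearI) (auto simp: matrix_vector_right_distrib matrix_vector_mult_scaleR algebra_simps)
    then have "convex (f -` {(0, 1)})" by (intro convex_linear_vimage convex_singleton)
    moreover have "convex ({u::real^'m. u \<ge> 0} \<times> dual_cone C)"
      by (intro convex_Times finitely_generated_cone_imp_convex finitely_generated_cone_orthant
          finitely_generated_dual_C)
    moreover have "\<T> = ({u. u \<ge> 0} \<times> dual_cone C) \<inter> f -` {(0, 1)}"
      by (auto simp: f_def dual_feasible_def transpose_Y_nonneg_iff)
    ultimately show ?thesis by (simp add: convex_Int)
  qed
  then have "convex hull (dual_obj b ` T) \<subseteq> dual_obj b ` \<T>"
    using T' by (intro hull_minimal convex_linear_image linear_dual_obj) auto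
  then show "convex hull (dual_obj b ` T) + convex_cone hull {- e_last} \<subseteq> lower_image B b P c Y"
    unfolding lower_image_def K_cone_uminus by (intro set_plus_mono2) auto
  show "lower_image B b P c Y \<subseteq> convex hull (dual_obj b ` T) + convex_cone hull {- e_last}"
    unfolding dual_returns_D(2)[OF T' ret] finished_outer_eq(3)[OF T ret S]
  proof (clarify)
    fix y' y assume y': "y' \<in> lower_image B b P c Y" and y: "y \<in> \<P>"
    have "lower_image B b P c Y \<subseteq> convex hull (dual_obj b ` \<T>) + convex_cone hull {- e_last}"
      unfolding lower_image_def K_cone_uminus by (intro set_plus_mono2 hull_subset order_refl)
    moreover have "y \<in> outer \<T>" using y by (simp add: outer_def primal_image_eq)
    ultimately show "coupling c y y' \<ge> 0" using y' coupling_outer[OF order_refl] by blast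
  qed
qed

section \<open>Invariant and termination\<close>

abbreviation "step \<equiv> alg_step brk B b P c Y Z Sbarh Tbarh"

definition "correct_output S Sh T Tp Td Tsp Tsd \<longleftrightarrow>
  Sh = Sbarh \<and> Tsd = {- e_last} \<and>
  primal_solution B b P C S Sh \<and>
  dual_solution B b P c Y T \<and>
  V_representation (upper_image B b P C) Tp Td \<and>
  V_representation (lower_image B b P c Y) Tsp Tsd"

text \<open>After a cut, \<open>T\<close> may no longer match \<open>Tsp\<close> and
  \<open>Tp\<close>, and the collected \<open>S\<close> is discarded before the next pass, so only
  admissibility is kept.\<close>

fun invariant where
  "invariant Init \<longleftrightarrow> True"
| "invariant (Pass_Start T) \<longleftrightarrow> admissible T"
| "invariant (For_Loop todo flag S T Tp Td Tsp) \<longleftrightarrow>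
     admissible T \<and>
     (\<not> flag \<longrightarrow>
        Tsp = dual_obj b ` T \<and> dual_returns c Tsp {- e_last} Tp Td \<and>
        (*v) P ` S \<union> set todo = Tp \<and> (\<forall>x\<in>S. minimizer B b P C x) \<and> finite S)"
| "invariant (Output S Sh T Tp Td Tsp Tsd) \<longleftrightarrow> correct_output S Sh T Tp Td Tsp Tsd"

lemma finished_correct_output:
  assumes T: "admissible T" and ret: "dual_returns c (dual_obj b ` T) {- e_last} ((*v) P ` S) Td"
    and S: "\<forall>x\<in>S. minimizer B b P C x" "finite S"
  shows "correct_output S Sbarh T ((*v) P ` S) Td (dual_obj b ` T) {- e_last}"
proof -
  have T': "T \<subseteq> \<T>" using T by (simp add: admissible_def)
  note lower = finished_lower_image[OF T ret S(1)]
  have "V_representation \<P> ((*v) P ` S) Td"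
    using dual_returns_D(1)[OF T' ret] finished_outer_eq(3)[OF T ret S(1)]
    by (simp add: minimal_V_representation_def)
  moreover have "V_representation (lower_image B b P c Y) (dual_obj b ` T) {- e_last}"
    using ret unfolding dual_returns_def V_representation_def lower by blast
  moreover have "dual_solution B b P c Y T"
    using T admissible_nonempty[OF T] lower
    by (auto simp: dual_solution_def finite_supremizer_def admissible_def K_cone_uminus lower_image_def)
  ultimately show ?thesis
    using finished_primal_solution[OF T ret S] by (simp add: correct_output_def)
qed

lemma admissible_insert:
  assumes "admissible T" "optimal_D2 B b P c Y t (u, w)"
  shows "admissible (insert (u, w) T)"
  using assms optimal_D2_maximizer[OF assms(2)] unfolding admissible_def
  by (auto simp: optimal_D2_iff)

lemma invariant_step:
  assumes "step s s'" "invariant s"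
  shows "invariant s'"
  using assms
proof cases
  case (step_0 f)
  have "{(f (u, w), w) |u w. (u, w) \<in> Tbarh} = (\<lambda>(u, w). (f (u, w), w)) ` Tbarh" by force
  moreover have "admissible ((\<lambda>(u, w). (f (u, w), w)) ` Tbarh)"
    unfolding admissible_def
  proof (intro conjI)
    have "maximizer B b P c Y (f (u, w), w)" if "(u, w) \<in> Tbarh" for u w
      using that step_0(3) Tbarh(3) by (intro optimal_D1_maximizer) auto
    then show "\<forall>p\<in>(\<lambda>(u, w). (f (u, w), w)) ` Tbarh. maximizer B b P c Y p" by auto
    then show "(\<lambda>(u, w). (f (u, w), w)) ` Tbarh \<subseteq> \<T>" unfolding maximizer_def by blast
    show "snd ` Tbarh \<subseteq> snd ` (\<lambda>(u, w). (f (u, w), w)) ` Tbarh" by force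
  qed (simp add: Tbarh(1))
  ultimately show ?thesis by (simp add: step_0)
next
  case (pass_start Tsp T Tp Td todo)
  have "{dual_obj b (u, w) |u w. (u, w) \<in> T} = dual_obj b ` T" by force
  then show ?thesis using pass_start assms(2) by auto
next
  case (cut t x z u w todo flag S T Tp Td Tsp)
  then show ?thesis using assms(2) admissible_insert by auto
next
  case (no_cut t x z u w todo flag S T Tp Td Tsp)
  show ?thesis
  proof (cases flag)
    case False
    then have T: "T \<subseteq> \<T>" "dual_returns c (dual_obj b ` T) {- e_last} Tp Td" "t \<in> Tp"
      using no_cut(1) assms(2) by (auto simp: admissible_def)
    then have "t extreme_point_of outer T"
      using dual_returns_D(1)[OF T(1,2)] by (auto simp: minimal_V_representation_def)
    from no_cut_vertex[OF T(1) this no_cut(3)] no_cut(5)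
    have "P *v x = t" "minimizer B b P C x" by auto
    then show ?thesis using no_cut(1,2) assms(2) False by auto
  qed (use no_cut assms(2) in auto)
next
  case (finish S T Tp Td Tsp)
  then show ?thesis using assms(2) finished_correct_output by auto
qed (use assms(2) in auto)

lemma invariant_reachable: "step\<^sup>*\<^sup>* Init s \<Longrightarrow> invariant s"
  by (induction rule: rtranclp_induct) (auto intro: invariant_step)

lemma step_exists:
  assumes "invariant s"
  shows "(\<exists>s'. step s s') \<or> (\<exists>S Sh T Tp Td Tsp Tsd. s = Output S Sh T Tp Td Tsp Tsd)"
proof (cases s)
  case Init
  have "\<forall>p\<in>Tbarh. \<exists>v. optimal_D1 B b P (snd p) v"
    using Tbarh(3) optimal_D1_exists by auto
  then obtain f where "\<forall>p\<in>Tbarh. optimal_D1 B b P (snd p) (f p)"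
    by (rule bchoice[THEN exE])
  then have "optimal_D1 B b P w (f (u, w))" if "(u, w) \<in> Tbarh" for u w
    using that by (metis snd_conv)
  then show ?thesis unfolding Init by (blast intro: alg_step.step_0)
next
  case (Pass_Start T)
  then have "admissible T" using assms by simp
  then obtain Tp Td where ret: "dual_returns c (dual_obj b ` T) {- e_last} Tp Td"
    using dual_returns_exists by blast
  have "finite Tp"
    using ret by (auto simp: dual_returns_def minimal_V_representation_def V_representation_def)
  then obtain todo where "set todo = Tp" "distinct todo" using finite_distinct_list by blast
  moreover have "dual_obj b ` T = {dual_obj b (u, w) |u w. (u, w) \<in> T}" by force
  ultimately show ?thesis using ret unfolding Pass_Start by (blast intro: alg_step.pass_start)
next
  case (For_Loop todo flag S T Tp Td Tsp)
  show ?thesis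
  proof (cases todo)
    case Nil
    then show ?thesis unfolding For_Loop
      by (cases flag) (auto intro: alg_step.repeat_pass alg_step.finish)
  next
    case (Cons t ts)
    obtain x z u w where "optimal_P2 B b P c Z t (x, z)" "optimal_D2 B b P c Y t (u, w)"
      using optimal_P2_exists[OF dual_feasible_nonempty] optimal_D2_exists[OF dual_feasible_nonempty] by metis
    then show ?thesis unfolding For_Loop Cons
      by (cases "z > 0") (blast intro: alg_step.cut alg_step.no_cut)+
  qed
qed auto

text \<open>
  The first cut of a pass lowers the number of uncovered pairs; this is why the states of a pass
  without a cut rank below its start, and those after a cut above the start of the next pass.
\<close>

fun rank where
  "rank Init = (Suc CARD('m set \<times> 'l set), 0::nat, 0)"
| "rank (Pass_Start T) = (uncovered T, 1, 0)"
| "rank (For_Loop todo flag S T Tp Td Tsp) = (uncovered T, if flag then 2 else 0, Suc (length todo))"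
| "rank (Output S Sh T Tp Td Tsp Tsd) = (0, 0, 0)"

abbreviation "rank_less \<equiv> less_than <*lex*> less_than <*lex*> less_than"

text \<open>The number of all index set pairs bounds \<open>uncovered\<close> and so pays for step
  0. The \<open>Suc\<close> around the length keeps the empty loop above \<open>Output\<close> even
  when nothing is uncovered.\<close>

lemma rank_step:
  assumes "step s s'" "invariant s"
  shows "(rank s', rank s) \<in> rank_less"
  using assms
proof cases
  case (step_0 f)
  have "uncovered T \<le> CARD('m set \<times> 'l set)" for T
    unfolding uncovered_def by (rule card_mono) auto
  then show ?thesis by (auto simp: step_0 less_Suc_eq_le)
next
  case (cut t x z u w todo flag S T Tp Td Tsp)
  show ?thesis
  proof (cases flag)
    case True
    have "uncovered (insert (u, w) T) \<le> uncovered T" by (rule uncovered_mono) auto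
    then show ?thesis using True cut by auto
  next
    case False
    then have T: "T \<subseteq> \<T>" "dual_returns c (dual_obj b ` T) {- e_last} Tp Td" "t \<in> Tp"
      using cut(1) assms(2) by (auto simp: admissible_def)
    then have "t \<in> outer T"
      using dual_returns_D(1)[OF T(1,2)]
      by (auto simp: minimal_V_representation_def extreme_point_of_def)
    from cut_uncovered[OF T(1) this cut(3,4,5)] show ?thesis using cut by auto
  qed
qed auto

theorem no_infinite_run:
  "\<not> (\<exists>\<sigma>. \<sigma> 0 = Init \<and> (\<forall>i::nat. step (\<sigma> i) (\<sigma> (Suc i))))"
proof
  assume "\<exists>\<sigma>. \<sigma> 0 = Init \<and> (\<forall>i::nat. step (\<sigma> i) (\<sigma> (Suc i)))"
  then obtain \<sigma> where \<sigma>: "\<sigma> 0 = Init" "\<And>i::nat. step (\<sigma> i) (\<sigma> (Suc i))" by blast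
  have "invariant (\<sigma> i)" for i
    by (induction i) (auto simp: \<sigma>(1) intro: invariant_step[OF \<sigma>(2)])
  then have "(rank (\<sigma> (Suc i)), rank (\<sigma> i)) \<in> rank_less" for i by (rule rank_step[OF \<sigma>(2)])
  then have "\<exists>f. \<forall>i. (f (Suc i), f i) \<in> rank_less" by (intro exI[of _ "\<lambda>i. rank (\<sigma> i)"]) blast
  moreover have "wf rank_less" by (intro wf_lex_prod wf_less_than)
  ultimately show False unfolding wf_iff_no_infinite_down_chain by blast
qed

end

theorem theorem4p5:
  fixes B :: "real ^ 'n ^ 'm"
    and b :: "real ^ 'm"
    and P :: "real ^ 'n ^ 'q::{finite,linorder}"
    and C :: "(real ^ 'q::{finite,linorder}) set"
    and c :: "real ^ 'q::{finite,linorder}"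
    and Y :: "real ^ 'k ^ 'q::{finite,linorder}"
    and Z :: "real ^ 'l ^ 'q::{finite,linorder}"
    and Sbarh :: "(real ^ 'n) set"
    and Tbarh :: "((real ^ 'm) \<times> (real ^ 'q::{finite,linorder})) set"
    and brk :: bool
  assumes "convex_cone C" and "polyhedron C" and "interior C \<noteq> {}" and "pointed C"
    and "convex_cone hull (columns Y) = C"
    and "convex_cone hull (columns Z) = dual_cone C"
    and "c \<in> interior C" and "c $ last_index = 1"
    and "feasible B b \<noteq> {}"
    and "\<exists>v. v extreme_point_of (upper_image B 0 P C)"
    and "primal_solution B 0 P C {0} Sbarh"
    and "dual_solution B 0 P c Y Tbarh"
  defines "step \<equiv> alg_step brk B b P c Y Z Sbarh Tbarh"
  shows
    \<comment> \<open>every step can be carried out\<close>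
    "(\<forall>s. step\<^sup>*\<^sup>* Init s \<longrightarrow>
        (\<exists>s'. step s s') \<or>
        (\<exists>S Sh T Tp Td Tsp Tsd. s = Output S Sh T Tp Td Tsp Tsd)) \<and>
     \<comment> \<open>there is no infinite run\<close>
     \<not> (\<exists>\<sigma>. \<sigma> 0 = Init \<and> (\<forall>i::nat. step (\<sigma> i) (\<sigma> (Suc i)))) \<and>
     \<comment> \<open>the results are correct upon termination\<close>
     (\<forall>S Sh T Tp Td Tsp Tsd. step\<^sup>*\<^sup>* Init (Output S Sh T Tp Td Tsp Tsd) \<longrightarrow>
        Sh = Sbarh \<and> Tsd = {- e_last} \<and>
        primal_solution B b P C S Sh \<and>
        dual_solution B b P c Y T \<and>
        V_representation (upper_image B b P C) Tp Td \<and>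
        V_representation (lower_image B b P c Y) Tsp Tsd)"
proof -
  interpret vlp_algorithm B b P C c Y Z Sbarh Tbarh brk
    using assms(1-12) by unfold_locales
  have "correct_output S Sh T Tp Td Tsp Tsd" if "step\<^sup>*\<^sup>* Init (Output S Sh T Tp Td Tsp Tsd)"
    for S Sh T Tp Td Tsp Tsd
    using invariant_reachable[of "Output S Sh T Tp Td Tsp Tsd"] that unfolding step_def by simp
  moreover have "(\<exists>s'. step s s') \<or> (\<exists>S Sh T Tp Td Tsp Tsd. s = Output S Sh T Tp Td Tsp Tsd)"
    if "step\<^sup>*\<^sup>* Init s" for s
    using step_exists[OF invariant_reachable] that unfolding step_def by blast
  moreover have "\<not> (\<exists>\<sigma>. \<sigma> 0 = Init \<and> (\<forall>i::nat. step (\<sigma> i) (\<sigma> (Suc i))))"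
    using no_infinite_run unfolding step_def .
  ultimately show ?thesis unfolding correct_output_def by blast
qed

end
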